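(* A real $A\subseteq\mathbb{N}$ is hyperarithmetic if and only if there is a density-1 real $B$ such that $B\geq_g\mathcal{R}(A)$.
   Context: Reals are subsets of $\mathbb{N}$, identified with their characteristic functions; for $n\in\mathbb{N}$ write $n=\{0,\dots,n-1\}$. A real $A$ is density-1 if $\lim_{n\to\infty}|A\cap n|/n=1$. A partial oracle for a real $C$ is a set $(C)$ of triples $\langle n,x,l\rangle$ (coded as natural numbers, so that $(C)$ is itself a real usable as a Turing oracle) such that $\langle n,0,l\rangle\in(C)$ implies $n\notin C$ and $\langle n,1,l\rangle\in(C)$ implies $n\in C$; its domain is $\mathrm{dom}((C))=\{n:\exists x\,\exists l\ \langle n,x,l\rangle\in(C)\}$. A generic oracle for $C$ is a partial oracle for $C$ whose domain is density-1. For an oracle $X$ and Turing functional $\varphi$, $\varphi^X$ is a generic computation of a real $D$ if $\mathrm{dom}(\varphi^X)$ is density-1, $\varphi^X$ takes only values in $\{0,1\}$, and $\varphi^X(n)=D(n)$ for all $n\in\mathrm{dom}(\varphi^X)$. For reals $C,D$, $C\geq_g D$ ($D$ is generically reducible to $C$) if there is a single Turing functional $\varphi$ such that for every generic oracle $(C)$ for $C$, $\varphi^{(C)}$ is a generic computation of $D$. For a real $X$, $\mathcal{R}(X)=\{2^m k: m\in X,\ k\in\mathbb{N},\ k \text{ odd}\}$. A real is hyperarithmetic if it is Turing reducible to $0^{(\alpha)}$ for some recursive ordinal $\alpha$ (equivalently, it is $\Delta^1_1$).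
   Formalization: In a partial oracle the answer x of a triple ⟨n,x,l⟩ is required to be 0 or 1; otherwise {⟨n,2,0⟩ : n∈ℕ} would be a generic oracle for every real and the equivalence would fail, e.g. for A the halting problem. *)

theory Defs
  imports Complex_Main "HOL-Library.Nat_Bijection"
begin

section \<open>Turing functionals\<close>

text \<open>
  Programs for the unary partial functions that are recursive in an oracle.
  Several arguments are passed through the pairing function \<^const>\<open>prod_encode\<close>.
  A Turing functional \<open>\<phi>\<close> is (given by) a program \<open>c\<close>, and \<open>\<phi>\<^sup>X\<close> is the partial
  function \<open>run X c\<close>.
\<close>

datatype code =
    Zero | Succ | Fst | Snd | Oracle
  | Pair code code
  | Comp code code
  | Prec code code
  | Mu code

text \<open>
  \<open>Prec f g\<close> satisfies \<open>h(a, 0) = f(a)\<close> and \<open>h(a, j + 1) = g(a, (j, h(a, j)))\<close>;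
  \<open>Mu f\<close> maps \<open>n\<close> to the least \<open>k\<close> with \<open>f(n, k) = 0\<close>, and is defined only if
  \<open>f(n, j)\<close> converges for all \<open>j < k\<close>.
\<close>

primrec run :: "nat set \<Rightarrow> code \<Rightarrow> nat \<rightharpoonup> nat" where
  "run X Zero = (\<lambda>n. Some 0)"
| "run X Succ = (\<lambda>n. Some (Suc n))"
| "run X Fst = (\<lambda>n. Some (fst (prod_decode n)))"
| "run X Snd = (\<lambda>n. Some (snd (prod_decode n)))"
| "run X Oracle = (\<lambda>n. Some (of_bool (n \<in> X)))"
| "run X (Pair f g) = (\<lambda>n.
     Option.bind (run X f n) (\<lambda>a. Option.bind (run X g n) (\<lambda>b. Some (prod_encode (a, b)))))"
| "run X (Comp f g) = (\<lambda>n. Option.bind (run X g n) (run X f))"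
| "run X (Prec f g) = (\<lambda>n. case prod_decode n of (a, k) \<Rightarrow>
     rec_nat (run X f a)
       (\<lambda>j r. Option.bind r (\<lambda>v. run X g (prod_encode (a, prod_encode (j, v))))) k)"
| "run X (Mu f) = (\<lambda>n.
     let zero_at = (\<lambda>k. run X f (prod_encode (n, k)) = Some 0 \<and>
                        (\<forall>j<k. \<exists>v>0. run X f (prod_encode (n, j)) = Some v))
     in if \<exists>k. zero_at k then Some (LEAST k. zero_at k) else None)"

definition turing_reducible :: "nat set \<Rightarrow> nat set \<Rightarrow> bool" (infix \<open>\<le>\<^sub>T\<close> 50) where
  "A \<le>\<^sub>T X \<longleftrightarrow> (\<exists>c. \<forall>n. run X c n = Some (of_bool (n \<in> A)))"

definition recursive_set :: "nat set \<Rightarrow> bool" where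
  "recursive_set A \<longleftrightarrow> A \<le>\<^sub>T {}"


section \<open>The transfinite jump and hyperarithmetic reals\<close>

text \<open>An explicit (hence effective) Goedel numbering of programs.\<close>

primrec code_num :: "code \<Rightarrow> nat" where
  "code_num Zero = prod_encode (0, 0)"
| "code_num Succ = prod_encode (1, 0)"
| "code_num Fst = prod_encode (2, 0)"
| "code_num Snd = prod_encode (3, 0)"
| "code_num Oracle = prod_encode (4, 0)"
| "code_num (Pair f g) = prod_encode (5, prod_encode (code_num f, code_num g))"
| "code_num (Comp f g) = prod_encode (6, prod_encode (code_num f, code_num g))"
| "code_num (Prec f g) = prod_encode (7, prod_encode (code_num f, code_num g))"
| "code_num (Mu f) = prod_encode (8, code_num f)"

lemma code_num_inject: "code_num c = code_num d \<longleftrightarrow> c = d"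
proof (induction c arbitrary: d)
  case Zero show ?case by (cases d) auto
next
  case Succ show ?case by (cases d) auto
next
  case Fst show ?case by (cases d) auto
next
  case Snd show ?case by (cases d) auto
next
  case Oracle show ?case by (cases d) auto
next
  case (Pair f g) then show ?case by (cases d) auto
next
  case (Comp f g) then show ?case by (cases d) auto
next
  case (Prec f g) then show ?case by (cases d) auto
next
  case (Mu f) then show ?case by (cases d) auto
qed

definition turing_jump :: "nat set \<Rightarrow> nat set" where
  "turing_jump X = {code_num c | c. code_num c \<in> dom (run X c)}"

text \<open>
  Recursive ordinals are the order types of recursive well-orderings of subsets of
  the natural numbers.  As usual in the library, \<^const>\<open>Well_order\<close> is about reflexive
  orders on \<^term>\<open>Field R\<close>.
\<close>

definition recursive_well_order :: "nat rel \<Rightarrow> bool" where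
  "recursive_well_order R \<longleftrightarrow> Well_order R \<and> recursive_set (prod_encode ` R)"

text \<open>
  For \<open>R\<close> of order type \<open>\<alpha>\<close>, \<open>0\<^sup>(\<^sup>\<alpha>\<^sup>)\<close> is the effective join of the sets \<open>(0\<^sup>(\<^sup>\<beta>\<^sup>))'\<close>
  for \<open>\<beta> < \<alpha>\<close>, where \<open>\<beta>\<close> is represented by the element of \<^term>\<open>Field R\<close> at
  position \<open>\<beta>\<close>.  So \<open>0\<^sup>(\<^sup>0\<^sup>)\<close> is empty, \<open>0\<^sup>(\<^sup>\<beta>\<^sup>+\<^sup>1\<^sup>)\<close> has the degree of \<open>(0\<^sup>(\<^sup>\<beta>\<^sup>))'\<close>, and at
  limits joins are taken.  \<open>iterated_jump_at R a\<close> is this set for the initial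
  segment of \<open>R\<close> strictly below \<open>a\<close>, and \<open>iterated_jump R\<close> the one for all of \<open>R\<close>.
\<close>

definition iterated_jump_at :: "nat rel \<Rightarrow> nat \<Rightarrow> nat set" where
  "iterated_jump_at R = wfrec (R - Id)
     (\<lambda>Z a. {prod_encode (b, x) | b x. (b, a) \<in> R - Id \<and> x \<in> turing_jump (Z b)})"

lemma iterated_jump_at_unfold:
  assumes "Well_order R"
  shows "iterated_jump_at R a =
    {prod_encode (b, x) | b x. (b, a) \<in> R - Id \<and> x \<in> turing_jump (iterated_jump_at R b)}"
proof -
  have "wf (R - Id)"
    using assms by (simp add: well_order_on_def)
  then show ?thesis
    unfolding iterated_jump_at_def by (subst wfrec) (auto simp: cut_apply)
qed

definition iterated_jump :: "nat rel \<Rightarrow> nat set" where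
  "iterated_jump R =
     {prod_encode (b, x) | b x. b \<in> Field R \<and> x \<in> turing_jump (iterated_jump_at R b)}"

definition hyperarithmetic :: "nat set \<Rightarrow> bool" where
  "hyperarithmetic A \<longleftrightarrow> (\<exists>R. recursive_well_order R \<and> A \<le>\<^sub>T iterated_jump R)"


section \<open>Generic reducibility\<close>

definition density_one :: "nat set \<Rightarrow> bool" where
  "density_one A \<longleftrightarrow> (\<lambda>n. real (card (A \<inter> {..<n})) / real n) \<longlonglongrightarrow> 1"

definition triple :: "nat \<Rightarrow> nat \<Rightarrow> nat \<Rightarrow> nat" where
  "triple n x l = prod_encode (n, prod_encode (x, l))"

text \<open>
  The middle component of a triple is an answer, so it is required to be 0 or 1;
  otherwise triples carrying no information would contribute to the domain.
\<close>

definition partial_oracle :: "nat set \<Rightarrow> nat set \<Rightarrow> bool" where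
  "partial_oracle P C \<longleftrightarrow>
     (\<forall>n x l. triple n x l \<in> P \<longrightarrow>
        x \<in> {0, 1} \<and> (x = 0 \<longrightarrow> n \<notin> C) \<and> (x = 1 \<longrightarrow> n \<in> C))"

definition oracle_dom :: "nat set \<Rightarrow> nat set" where
  "oracle_dom P = {n. \<exists>x l. triple n x l \<in> P}"

definition generic_oracle :: "nat set \<Rightarrow> nat set \<Rightarrow> bool" where
  "generic_oracle P C \<longleftrightarrow> partial_oracle P C \<and> density_one (oracle_dom P)"

definition generic_computation :: "(nat \<rightharpoonup> nat) \<Rightarrow> nat set \<Rightarrow> bool" where
  "generic_computation f D \<longleftrightarrow>
     density_one (dom f) \<and> ran f \<subseteq> {0, 1} \<and> (\<forall>n \<in> dom f. f n = Some (of_bool (n \<in> D)))"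

definition generically_reduces :: "nat set \<Rightarrow> nat set \<Rightarrow> bool" (infix \<open>\<ge>\<^sub>g\<close> 50) where
  "C \<ge>\<^sub>g D \<longleftrightarrow> (\<exists>c. \<forall>P. generic_oracle P C \<longrightarrow> generic_computation (run P c) D)"

definition \<R> :: "nat set \<Rightarrow> nat set" where
  "\<R> X = {2 ^ m * k | m k. m \<in> X \<and> odd k}"

end

theory Submission
  imports Defs
begin

text \<open>
  Suppose \<open>A\<close> is computable from an iterated jump along a recursive well-order. The table \<open>w\<close> of
  all computations relative to all stages of the iteration is the only path of a recursive closed
  subset of Baire space: its entries are tied together by conditions each of which concerns a few
  entries only, and the well-order leaves no freedom. By compactness, \<open>w\<close> is computable from
  every function that dominates it, uniformly. Let \<open>B\<close> omit \<open>2\<^sup>m * k\<close> (\<open>k\<close> odd) if it is at most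
  \<open>w m\<close>. Then \<open>B\<close> has density one, and as every generic oracle for \<open>B\<close> confirms some number
  \<open>2\<^sup>m * k\<close> for each \<open>m\<close>, it computes a function dominating \<open>w\<close>.

  Conversely, let \<open>c\<close> witness \<open>B \<ge>\<^sub>g \<R> A\<close>. Call a density-one set a \<open>v\<close>-candidate at \<open>n\<close> if
  positive information about it never makes \<open>c\<close> answer \<open>v\<close> at a number \<open>2\<^sup>n * k\<close> with \<open>k\<close> odd. If
  \<open>v\<close> is the wrong value of \<open>A\<close> at \<open>n\<close> then \<open>B\<close> is a candidate. If \<open>v\<close> is the right value then
  there is none, since a candidate could be intersected with \<open>B\<close>. In the game where two players
  simultaneously build a \<open>0\<close>-candidate and a \<open>1\<close>-candidate at \<open>n\<close>, one of the players therefore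
  gets stuck, and which one decides \<open>A\<close> at \<open>n\<close>. The game tree is recursive and well-founded, and
  the winning positions are computed by iterating the jump along its Kleene-Brouwer order.
\<close>

section \<open>Computable functions\<close>

abbreviation p1 :: "nat \<Rightarrow> nat" where "p1 n \<equiv> fst (prod_decode n)"
abbreviation p2 :: "nat \<Rightarrow> nat" where "p2 n \<equiv> snd (prod_decode n)"

text \<open>One program must serve all oracles in \<open>S\<close>. This uniformity is what
  \<open>\<ge>\<^sub>g\<close> demands when \<open>S\<close> consists of generic oracles; a
  singleton \<open>S\<close> gives Turing reducibility.\<close>

definition computable_on :: "nat set set \<Rightarrow> (nat set \<Rightarrow> nat \<Rightarrow> nat) \<Rightarrow> bool" where
  "computable_on S F \<longleftrightarrow> (\<exists>c. \<forall>X\<in>S. \<forall>n. run X c n = Some (F X n))"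

abbreviation decidable_on :: "nat set set \<Rightarrow> (nat set \<Rightarrow> nat \<Rightarrow> bool) \<Rightarrow> bool" where
  "decidable_on S Q \<equiv> computable_on S (\<lambda>X n. of_bool (Q X n))"

lemma computable_onI:
  assumes "\<And>X n. X \<in> S \<Longrightarrow> run X c n = Some (F X n)"
  shows "computable_on S F"
  using assms unfolding computable_on_def by blast

lemma computable_on_cong:
  assumes "computable_on S F" "\<And>X n. X \<in> S \<Longrightarrow> F X n = G X n"
  shows "computable_on S G"
  using assms unfolding computable_on_def by metis

lemma turing_reducible_iff: "A \<le>\<^sub>T X \<longleftrightarrow> decidable_on {X} (\<lambda>X n. n \<in> A)"
  by (simp add: turing_reducible_def computable_on_def)

lemma computable_on_compose:
  assumes "computable_on S F" "computable_on S f"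
  shows "computable_on S (\<lambda>X n. F X (f X n))"
proof -
  from assms obtain c d where "\<And>X n. X \<in> S \<Longrightarrow> run X c n = Some (F X n)"
    "\<And>X n. X \<in> S \<Longrightarrow> run X d n = Some (f X n)"
    unfolding computable_on_def by blast
  then show ?thesis by (intro computable_onI[where c = "Comp c d"]) simp
qed

lemma computable_on_pair:
  assumes "computable_on S f" "computable_on S g"
  shows "computable_on S (\<lambda>X n. prod_encode (f X n, g X n))"
proof -
  from assms obtain c d where "\<And>X n. X \<in> S \<Longrightarrow> run X c n = Some (f X n)"
    "\<And>X n. X \<in> S \<Longrightarrow> run X d n = Some (g X n)"
    unfolding computable_on_def by blast
  then show ?thesis by (intro computable_onI[where c = "Pair c d"]) simp
qed

lemma computable_on_compose2:
  assumes "computable_on S (\<lambda>X m. F X (p1 m) (p2 m))" "computable_on S f" "computable_on S g"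
  shows "computable_on S (\<lambda>X n. F X (f X n) (g X n))"
  using computable_on_compose[OF assms(1) computable_on_pair[OF assms(2,3)]] by simp

lemma computable_on_id: "computable_on S (\<lambda>X n. n)"
  by (rule computable_onI[where c = "Pair Fst Snd"]) simp

lemma computable_on_p1:
  assumes "computable_on S f"
  shows "computable_on S (\<lambda>X n. p1 (f X n))"
  by (rule computable_on_compose[OF computable_onI[where c = Fst] assms]) simp

lemma computable_on_p2:
  assumes "computable_on S f"
  shows "computable_on S (\<lambda>X n. p2 (f X n))"
  by (rule computable_on_compose[OF computable_onI[where c = Snd] assms]) simp

lemma computable_on_Suc:
  assumes "computable_on S f"
  shows "computable_on S (\<lambda>X n. Suc (f X n))"
  by (rule computable_on_compose[OF computable_onI[where c = Succ] assms]) simp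

section \<open>Numerals, primitive recursion and arithmetic\<close>

primrec numeral_code :: "nat \<Rightarrow> code" where
  "numeral_code 0 = Zero"
| "numeral_code (Suc k) = Comp Succ (numeral_code k)"

lemma run_numeral_code [simp]: "run X (numeral_code k) n = Some k"
  by (induction k) auto

lemma computable_on_const: "computable_on S (\<lambda>X n. k)"
  by (rule computable_onI[where c = "numeral_code k"]) simp

lemma computable_on_oracle:
  assumes "computable_on S f"
  shows "decidable_on S (\<lambda>X n. f X n \<in> X)"
  by (rule computable_on_compose[OF computable_onI[where c = Oracle] assms]) simp

lemma computable_on_rec_nat:
  assumes F: "computable_on S F"
    and G: "computable_on S (\<lambda>X m. G X (p1 m) (p1 (p2 m)) (p2 (p2 m)))"
    and k: "computable_on S k"
  shows "computable_on S (\<lambda>X n. rec_nat (F X n) (G X n) (k X n))"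
proof -
  from F G obtain c d where c: "\<And>X n. X \<in> S \<Longrightarrow> run X c n = Some (F X n)"
    and d: "\<And>X m. X \<in> S \<Longrightarrow> run X d m = Some (G X (p1 m) (p1 (p2 m)) (p2 (p2 m)))"
    unfolding computable_on_def by metis
  have "run X (Prec c d) (prod_encode (n, k)) = Some (rec_nat (F X n) (G X n) k)"
    if "X \<in> S" for X n k
    by (induction k) (use that c d in auto)
  then have "run X (Prec c d) m = Some (rec_nat (F X (p1 m)) (G X (p1 m)) (p2 m))"
    if "X \<in> S" for X m
    using that by (metis prod.collapse prod_decode_inverse)
  then have "computable_on S (\<lambda>X m. rec_nat (F X (p1 m)) (G X (p1 m)) (p2 m))"
    by (rule computable_onI)
  from computable_on_compose2[OF this computable_on_id k] show ?thesis .
qed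

lemmas computable_basic = computable_on_p1 computable_on_p2 computable_on_Suc computable_on_pair
  computable_on_id

lemma computable_on_if:
  assumes "decidable_on S Q" "computable_on S f" "computable_on S g"
  shows "computable_on S (\<lambda>X n. if Q X n then f X n else g X n)"
proof -
  \<comment> \<open>A case distinction is a primitive recursion that runs for one step or for
    none.\<close>
  have "computable_on S (\<lambda>X n. rec_nat (g X n) (\<lambda>_ _. f X n) (of_bool (Q X n)))"
    by (intro computable_on_rec_nat assms computable_on_compose[OF assms(2)] computable_basic)
  then show ?thesis by (rule computable_on_cong) auto
qed

lemma decidable_on_not:
  assumes "decidable_on S Q"
  shows "decidable_on S (\<lambda>X n. \<not> Q X n)"
proof -
  have "computable_on S (\<lambda>X n. if Q X n then 0 else 1)"
    by (intro computable_on_if assms computable_on_const)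
  then show ?thesis by (rule computable_on_cong) auto
qed

lemma decidable_on_conj:
  assumes "decidable_on S Q" "decidable_on S R"
  shows "decidable_on S (\<lambda>X n. Q X n \<and> R X n)"
proof -
  have "computable_on S (\<lambda>X n. if Q X n then of_bool (R X n) else 0)"
    by (intro computable_on_if assms computable_on_const)
  then show ?thesis by (rule computable_on_cong) auto
qed

lemma decidable_on_disj:
  assumes "decidable_on S Q" "decidable_on S R"
  shows "decidable_on S (\<lambda>X n. Q X n \<or> R X n)"
  using decidable_on_not[OF decidable_on_conj[OF decidable_on_not[OF assms(1)] decidable_on_not[OF assms(2)]]]
  by (rule computable_on_cong) simp

lemma decidable_on_imp:
  assumes "decidable_on S Q" "decidable_on S R"
  shows "decidable_on S (\<lambda>X n. Q X n \<longrightarrow> R X n)"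
  using decidable_on_disj[OF decidable_on_not[OF assms(1)] assms(2)]
  by (rule computable_on_cong) simp

lemma decidable_on_if:
  assumes "decidable_on S Q" "decidable_on S R" "decidable_on S T"
  shows "decidable_on S (\<lambda>X n. if Q X n then R X n else T X n)"
  using computable_on_if[OF assms] by (rule computable_on_cong) auto

lemma computable_on_add:
  assumes "computable_on S f" "computable_on S g"
  shows "computable_on S (\<lambda>X n. f X n + g X n)"
proof -
  have "computable_on S (\<lambda>X n. rec_nat (f X n) (\<lambda>_ v. Suc v) (g X n))"
    by (intro computable_on_rec_nat assms computable_basic)
  moreover have eq: "rec_nat a (\<lambda>_ v. Suc v) k = a + k" for a k :: nat
    by (induction k) auto
  ultimately show ?thesis by (simp only: eq)
qed

lemma computable_on_mult:
  assumes "computable_on S f" "computable_on S g"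
  shows "computable_on S (\<lambda>X n. f X n * g X n)"
proof -
  have "computable_on S (\<lambda>X n. rec_nat 0 (\<lambda>_ v. v + f X n) (g X n))"
    by (intro computable_on_rec_nat computable_on_add computable_on_compose[OF assms(1)]
        assms(2) computable_basic computable_on_const)
  moreover have eq: "rec_nat 0 (\<lambda>_ v. v + a) k = a * k" for a k :: nat
    by (induction k) auto
  ultimately show ?thesis by (simp only: eq)
qed

lemma computable_on_power:
  assumes "computable_on S f" "computable_on S g"
  shows "computable_on S (\<lambda>X n. f X n ^ g X n)"
proof -
  have "computable_on S (\<lambda>X n. rec_nat 1 (\<lambda>_ v. v * f X n) (g X n))"
    by (intro computable_on_rec_nat computable_on_mult computable_on_compose[OF assms(1)]
        assms(2) computable_basic computable_on_const)
  moreover have eq: "rec_nat 1 (\<lambda>_ v. v * a) k = a ^ k" for a k :: nat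
    by (induction k) auto
  ultimately show ?thesis by (simp only: eq)
qed

lemma computable_on_diff:
  assumes "computable_on S f" "computable_on S g"
  shows "computable_on S (\<lambda>X n. f X n - g X n)"
proof -
  have "computable_on S (\<lambda>X n. rec_nat 0 (\<lambda>j _. j) n)"
    by (intro computable_on_rec_nat computable_basic computable_on_const)
  moreover have eq: "rec_nat 0 (\<lambda>j _. j) k = k - 1" for k :: nat
    by (cases k) auto
  ultimately have pred: "computable_on S (\<lambda>X n. n - 1)" by (simp only: eq)
  have "computable_on S (\<lambda>X n. rec_nat (f X n) (\<lambda>_ v. v - 1) (g X n))"
    by (intro computable_on_rec_nat computable_on_compose[OF pred] computable_basic assms)
  moreover have eq: "rec_nat a (\<lambda>_ v. v - 1) k = a - k" for a k :: nat
    by (induction k) auto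
  ultimately show ?thesis by (simp only: eq)
qed

lemma decidable_on_le:
  assumes "computable_on S f" "computable_on S g"
  shows "decidable_on S (\<lambda>X n. f X n \<le> g X n)"
proof -
  have "computable_on S (\<lambda>X n. 1 - (f X n - g X n))"
    by (intro computable_on_diff computable_on_const assms)
  then show ?thesis by (rule computable_on_cong) auto
qed

lemma decidable_on_less:
  assumes "computable_on S f" "computable_on S g"
  shows "decidable_on S (\<lambda>X n. f X n < g X n)"
  using decidable_on_le[OF computable_on_Suc[OF assms(1)] assms(2)]
  by (rule computable_on_cong) (simp add: Suc_le_eq)

lemma decidable_on_eq:
  assumes "computable_on S f" "computable_on S g"
  shows "decidable_on S (\<lambda>X n. f X n = g X n)"
  using decidable_on_conj[OF decidable_on_le[OF assms] decidable_on_le[OF assms(2,1)]]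
  by (rule computable_on_cong) auto

lemma computable_on_sum:
  assumes f: "computable_on S (\<lambda>X m. f X (p1 m) (p2 m))" and k: "computable_on S k"
  shows "computable_on S (\<lambda>X n. \<Sum>j<k X n. f X n j)"
proof -
  have "computable_on S (\<lambda>X n. rec_nat 0 (\<lambda>j v. v + f X n j) (k X n))"
    by (intro computable_on_rec_nat computable_on_add computable_on_compose2[OF f]
        k computable_basic computable_on_const)
  moreover have eq: "rec_nat 0 (\<lambda>j v. v + h j) k = (\<Sum>j<k. h j)" for h :: "nat \<Rightarrow> nat" and k
    by (induction k) auto
  ultimately show ?thesis by (simp only: eq)
qed

lemma decidable_on_all_less:
  assumes Q: "decidable_on S (\<lambda>X m. Q X (p1 m) (p2 m))" and k: "computable_on S k"
  shows "decidable_on S (\<lambda>X n. \<forall>j<k X n. Q X n j)"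
proof -
  have "decidable_on S (\<lambda>X n. (\<Sum>j<k X n. of_bool (\<not> Q X n j) :: nat) = 0)"
    by (intro decidable_on_eq computable_on_sum decidable_on_not Q k computable_on_const)
  then show ?thesis by (rule computable_on_cong) auto
qed

lemma decidable_on_ex_less:
  assumes Q: "decidable_on S (\<lambda>X m. Q X (p1 m) (p2 m))" and k: "computable_on S k"
  shows "decidable_on S (\<lambda>X n. \<exists>j<k X n. Q X n j)"
  using decidable_on_not[OF decidable_on_all_less[OF decidable_on_not[OF Q] k]]
  by (rule computable_on_cong) simp

lemma decidable_on_all_le:
  assumes Q: "decidable_on S (\<lambda>X m. Q X (p1 m) (p2 m))" and k: "computable_on S k"
  shows "decidable_on S (\<lambda>X n. \<forall>j\<le>k X n. Q X n j)"
  using decidable_on_all_less[OF Q computable_on_Suc[OF k]] by (rule computable_on_cong) (simp add: less_Suc_eq_le)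

lemmas computable_intros = computable_on_p1 computable_on_p2 computable_on_Suc computable_on_pair
  computable_on_id computable_on_if computable_on_add computable_on_mult computable_on_power
  computable_on_diff computable_on_sum decidable_on_not decidable_on_conj decidable_on_disj
  decidable_on_imp decidable_on_if decidable_on_le decidable_on_less decidable_on_eq
  decidable_on_all_less decidable_on_ex_less decidable_on_all_le computable_on_const

text \<open>The divergent case is kept because halting of this program, not only its value, matters
  later: a jump answers whether some \<open>k\<close> satisfies \<open>Q\<close>.\<close>

lemma unbounded_search:
  assumes Q: "decidable_on S (\<lambda>X m. Q X (p1 m) (p2 m))"
  obtains c where "\<And>X n. X \<in> S \<Longrightarrow>
    run X c n = (if \<exists>k. Q X n k then Some (LEAST k. Q X n k) else None)"
proof -
  from decidable_on_not[OF Q] obtain d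
    where d: "\<And>X m. X \<in> S \<Longrightarrow> run X d m = Some (of_bool (\<not> Q X (p1 m) (p2 m)))"
    unfolding computable_on_def by blast
  have "run X (Mu d) n = (if \<exists>k. Q X n k then Some (LEAST k. Q X n k) else None)" if X: "X \<in> S" for X n
  proof -
    let ?z = "\<lambda>k. Q X n k \<and> (\<forall>j<k. \<not> Q X n j)"
    have z: "(run X d (prod_encode (n, k)) = Some 0 \<and>
        (\<forall>j<k. \<exists>v>0. run X d (prod_encode (n, j)) = Some v)) \<longleftrightarrow> ?z k" for k
      by (simp add: d[OF X])
    have run: "run X (Mu d) n = (if \<exists>k. ?z k then Some (LEAST k. ?z k) else None)"
      by (simp only: run.simps Let_def z)
    show ?thesis
    proof (cases "\<exists>k. Q X n k")
      case True
      have z: "?z (LEAST k. Q X n k)"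
        using LeastI_ex[OF True] not_less_Least by blast
      moreover have "(LEAST k. ?z k) = (LEAST k. Q X n k)"
        using z by (rule Least_equality) (blast intro: Least_le)
      ultimately show ?thesis using True unfolding run by (metis (lifting))
    next
      case False
      then show ?thesis unfolding run by metis
    qed
  qed
  then show thesis by (rule that)
qed

lemma computable_on_Least:
  assumes Q: "decidable_on S (\<lambda>X m. Q X (p1 m) (p2 m))"
    and ex: "\<And>X n. X \<in> S \<Longrightarrow> \<exists>k. Q X n k"
  shows "computable_on S (\<lambda>X n. LEAST k. Q X n k)"
proof -
  obtain c where "\<And>X n. X \<in> S \<Longrightarrow>
    run X c n = (if \<exists>k. Q X n k then Some (LEAST k. Q X n k) else None)"
    using unbounded_search[OF Q] by blast
  with ex show ?thesis by (intro computable_onI[where c = c]) simp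
qed

section \<open>Change of oracle\<close>

primrec substitute_oracle :: "code \<Rightarrow> code \<Rightarrow> code" where
  "substitute_oracle d Zero = Zero"
| "substitute_oracle d Succ = Succ"
| "substitute_oracle d Fst = Fst"
| "substitute_oracle d Snd = Snd"
| "substitute_oracle d Oracle = d"
| "substitute_oracle d (Pair f g) = Pair (substitute_oracle d f) (substitute_oracle d g)"
| "substitute_oracle d (Comp f g) = Comp (substitute_oracle d f) (substitute_oracle d g)"
| "substitute_oracle d (Prec f g) = Prec (substitute_oracle d f) (substitute_oracle d g)"
| "substitute_oracle d (Mu f) = Mu (substitute_oracle d f)"

lemma run_substitute_oracle:
  assumes "\<And>n. run X d n = Some (of_bool (n \<in> Y))"
  shows "run X (substitute_oracle d c) = run Y c"
  by (induction c) (auto simp: assms)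

lemma decidable_on_turing_reducible:
  assumes "A \<le>\<^sub>T Y" "decidable_on S (\<lambda>X n. n \<in> Y)"
  shows "decidable_on S (\<lambda>X n. n \<in> A)"
proof -
  from assms obtain c d where "\<And>n. run Y c n = Some (of_bool (n \<in> A))"
    "\<And>X n. X \<in> S \<Longrightarrow> run X d n = Some (of_bool (n \<in> Y))"
    unfolding computable_on_def turing_reducible_def by blast
  then show ?thesis
    by (intro computable_onI[where c = "substitute_oracle d c"]) (metis run_substitute_oracle)
qed

lemma decidable_on_recursive_set:
  assumes "recursive_set A"
  shows "decidable_on S (\<lambda>X n. n \<in> A)"
  by (rule decidable_on_turing_reducible[OF assms[unfolded recursive_set_def]])
    (simp add: computable_on_const)

section \<open>Coded lists\<close>

text \<open>The shift by one leaves \<open>0\<close> for positions outside the list, so that every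
  number codes a finite partial function in the convention used for tables below.\<close>

definition look :: "nat \<Rightarrow> nat \<Rightarrow> nat" where
  "look s i = (if i < length (list_decode s) then Suc (list_decode s ! i) else 0)"

lemma prod_decode_0: "prod_decode 0 = (0, 0)"
  using prod_encode_inverse[of "(0, 0)"] by (simp add: prod_encode_def del: prod_encode_inverse)

lemma computable_on_look:
  assumes "computable_on S f" "computable_on S g"
  shows "computable_on S (\<lambda>X n. look (f X n) (g X n))"
proof -
  \<comment> \<open>The code of \<open>x # u\<close> is the successor of the pair of
    \<open>x\<close> and the code of \<open>u\<close>, so this iteration passes to tails. It stays
    at \<open>0\<close>, the empty list, since \<open>0\<close> decodes to
    \<open>(0, 0)\<close>.\<close>
  have drop: "rec_nat (list_encode u) (\<lambda>_ v. p2 (v - 1)) i = list_encode (drop i u)" for u i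
  proof (induction i)
    case (Suc i)
    have "drop (Suc i) u = tl (drop i u)" by (simp add: drop_Suc drop_tl)
    moreover have "p2 (list_encode v - 1) = list_encode (tl v)" for v
      by (cases v) (auto simp: prod_decode_0)
    ultimately show ?case using Suc by simp
  qed simp
  define D where "D s i = rec_nat s (\<lambda>_ v. p2 (v - 1)) i" for s i
  have look: "look s i = (if D s i = 0 then 0 else Suc (p1 (D s i - 1)))" for s i
  proof -
    have D: "D s i = list_encode (drop i (list_decode s))"
      using drop[of "list_decode s"] by (simp add: D_def)
    show ?thesis
    proof (cases "i < length (list_decode s)")
      case True
      then show ?thesis
        unfolding D look_def by (subst (1 2) Cons_nth_drop_Suc[OF True, symmetric]) simp
    qed (simp add: D look_def)
  qed
  have D: "computable_on S (\<lambda>X n. D (f X n) (g X n))"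
    unfolding D_def by (intro computable_on_rec_nat computable_intros assms)
  have "computable_on S (\<lambda>X n. if D (f X n) (g X n) = 0 then 0 else Suc (p1 (D (f X n) (g X n) - 1)))"
    by (intro computable_intros D)
  then show ?thesis by (simp only: look)
qed

lemma length_le_list_encode: "length u \<le> list_encode u"
proof (induction u)
  case (Cons x u)
  then show ?case using le_prod_encode_2[of "list_encode u" x] by simp
qed simp

definition look_list :: "nat list \<Rightarrow> nat \<Rightarrow> nat" where
  "look_list u i = (if i < length u then Suc (u ! i) else 0)"

lemma look_list_encode [simp]: "look (list_encode u) = look_list u"
  by (simp add: look_def look_list_def fun_eq_iff)

section \<open>Closed classes of functions\<close>

definition partial_le :: "(nat \<Rightarrow> nat) \<Rightarrow> (nat \<Rightarrow> nat) \<Rightarrow> bool" where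
  "partial_le G G' \<longleftrightarrow> (\<forall>j. G j = 0 \<or> G j = G' j)"

abbreviation initial :: "(nat \<Rightarrow> nat) \<Rightarrow> nat \<Rightarrow> nat \<Rightarrow> nat" where
  "initial f L \<equiv> look_list (map f [0..<L])"

lemma initial_eq: "initial f L j = (if j < L then Suc (f j) else 0)"
  by (simp add: look_list_def)

text \<open>Forgetting values never breaks a condition, and a violation by a total function shows on
  a finite initial segment. So the paths form a closed subset of Baire space, effectively closed
  once \<open>C\<close> is decidable.\<close>

definition closed_class :: "((nat \<Rightarrow> nat) \<Rightarrow> nat \<Rightarrow> bool) \<Rightarrow> bool" where
  "closed_class C \<longleftrightarrow>
     (\<forall>G G' i. partial_le G G' \<longrightarrow> C G' i \<longrightarrow> C G i) \<and>
     (\<forall>f i. (\<forall>L. C (initial f L) i) \<longrightarrow> C (\<lambda>j. Suc (f j)) i)"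

definition path :: "((nat \<Rightarrow> nat) \<Rightarrow> nat \<Rightarrow> bool) \<Rightarrow> (nat \<Rightarrow> nat) \<Rightarrow> bool" where
  "path C f \<longleftrightarrow> (\<forall>i. C (\<lambda>j. Suc (f j)) i)"

lemma closed_class_antimono:
  assumes "closed_class C" "partial_le G G'" "C G' i"
  shows "C G i"
  using assms unfolding closed_class_def by blast

lemma closed_class_limit:
  assumes "closed_class C" "\<And>L. C (initial f L) i"
  shows "C (\<lambda>j. Suc (f j)) i"
  using assms unfolding closed_class_def by blast

lemma partial_le_initial: "partial_le (initial f L) (\<lambda>j. Suc (f j))"
  by (simp add: partial_le_def initial_eq)

text \<open>Dependent choice: the one-entry extensions cohere to the values of a single
  function.\<close>

lemma list_limit:
  assumes "P []" and step: "\<And>p. P p \<Longrightarrow> \<exists>k. P (p @ [k])"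
  obtains f :: "nat \<Rightarrow> nat" where "\<And>L. P (map f [0..<L])"
proof -
  have "\<exists>F :: nat \<Rightarrow> nat list. \<forall>n. (P (F n) \<and> length (F n) = n) \<and> (\<exists>k. F (Suc n) = F n @ [k])"
  proof (rule dependent_nat_choice)
    show "\<exists>x. P x \<and> length x = 0" using assms(1) by auto
    fix x n assume "P x \<and> length x = n"
    then show "\<exists>y. (P y \<and> length y = Suc n) \<and> (\<exists>k. y = x @ [k])"
      using step[of x] by force
  qed
  then obtain F where F: "\<And>n. P (F n)" "\<And>n. length (F n) = n"
    and Suc: "\<And>n. \<exists>k. F (Suc n) = F n @ [k]"
    by blast
  have "F n = map (\<lambda>n. F (Suc n) ! n) [0..<n]" for n
  proof (induction n)
    case 0
    then show ?case using F(2)[of 0] by simp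
  next
    case (Suc n)
    obtain k where "F (Suc n) = F n @ [k]" using Suc.prems \<open>\<And>n. \<exists>k. F (Suc n) = F n @ [k]\<close> by blast
    then show ?case using Suc F(2)[of n] by (auto simp: nth_append)
  qed
  then show thesis using that F(1) by metis
qed

text \<open>Koenig's lemma, applied to the strings that are bounded by \<open>g\<close> and wrong at \<open>i\<close>.\<close>

lemma unique_path_compactness:
  assumes closed: "closed_class C" and unique: "\<And>f. path C f \<Longrightarrow> f = w"
  shows "\<exists>s>i. \<forall>u. length u = s \<and> (\<forall>j<s. u ! j \<le> g j) \<and> (\<forall>l<s. C (look_list u) l) \<longrightarrow> u ! i = w i"
proof (rule ccontr)
  assume no: "\<not> ?thesis"
  define bad where "bad u \<longleftrightarrow> i < length u \<and> (\<forall>j<length u. u ! j \<le> g j) \<and>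
    (\<forall>l<length u. C (look_list u) l) \<and> u ! i \<noteq> w i" for u
  define E where "E p \<longleftrightarrow> (\<forall>N. \<exists>u. bad u \<and> N \<le> length u \<and> (\<exists>v. u = p @ v))" for p
  have start: "E []"
    unfolding E_def
  proof
    fix N
    define s where "s = max N (Suc i)"
    have "i < s" "N \<le> s" by (auto simp: s_def)
    from no \<open>i < s\<close> have "\<not> (\<forall>u. length u = s \<and> (\<forall>j<s. u ! j \<le> g j) \<and> (\<forall>l<s. C (look_list u) l) \<longrightarrow> u ! i = w i)"
      by meson
    then obtain u where "length u = s" "bad u"
      using \<open>i < s\<close> by (auto simp: bad_def)
    then show "\<exists>u. bad u \<and> N \<le> length u \<and> (\<exists>v. u = [] @ v)" using \<open>N \<le> s\<close> by auto
  qed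
  have step: "\<exists>k. E (p @ [k])" if p: "E p" for p
  proof (rule ccontr)
    assume "\<nexists>k. E (p @ [k])"
    then obtain N where N: "\<And>k u. bad u \<Longrightarrow> N k \<le> length u \<Longrightarrow> \<nexists>v. u = (p @ [k]) @ v"
      unfolding E_def by metis
    \<comment> \<open>A bad extension of \<open>p\<close> of this length has a next entry
      \<open>k\<close>, bounded by \<open>g (length p)\<close>, and is longer than
      \<open>N k\<close> for each of these finitely many \<open>k\<close>.\<close>
    define M where "M = Suc (length p) + (\<Sum>k\<le>g (length p). N k)"
    obtain u v where u: "bad u" "M \<le> length u" "u = p @ v"
      using p[unfolded E_def, THEN spec[where x = M]] by blast
    then obtain k v' where v: "v = k # v'"
      by (cases v) (auto simp: M_def)
    have "length p < length u" using u(2) by (simp add: M_def)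
    then have "u ! length p \<le> g (length p)"
      using u(1) unfolding bad_def by blast
    then have "k \<le> g (length p)" using u(3) v by simp
    then have "N k \<le> (\<Sum>k\<le>g (length p). N k)" by (intro member_le_sum) auto
    then have "N k \<le> length u" using u(2) by (simp add: M_def)
    from N[OF u(1) this] show False using u(3) v by simp
  qed
  obtain f where f: "\<And>L. E (map f [0..<L])"
    using list_limit[of E, OF start step] by blast
  have "C (initial f L) l" for L l
  proof -
    obtain u v where u: "bad u" "Suc l \<le> length u" "u = map f [0..<L] @ v"
      using f[of L, unfolded E_def, THEN spec[where x = "Suc l"]] by blast
    then have "C (look_list u) l" by (simp add: bad_def del: append_eq_append_conv)
    moreover have "partial_le (initial f L) (look_list u)"
      unfolding partial_le_def u(3) by (auto simp: look_list_def nth_append)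
    ultimately show ?thesis by (rule closed_class_antimono[OF closed, rotated])
  qed
  then have "path C f" unfolding path_def using closed_class_limit[OF closed] by blast
  then have "f = w" by (rule unique)
  obtain u v where "bad u" "u = map f [0..<Suc i] @ v"
    using f[of "Suc i", unfolded E_def, THEN spec[where x = 0]] by blast
  then have "f i \<noteq> w i" unfolding bad_def by (simp add: nth_append del: upt_Suc)
  with \<open>f = w\<close> show False by simp
qed

section \<open>Computing a unique path from a bound\<close>

lemma prod_encode_mono:
  assumes "a \<le> a'" "b \<le> b'"
  shows "prod_encode (a, b) \<le> prod_encode (a', b')"
proof -
  have "triangle (a + b) \<le> triangle (a' + b')"
    unfolding triangle_def using assms by (intro div_le_mono mult_le_mono) auto
  then show ?thesis using assms by (simp add: prod_encode_def)
qed

lemma list_encode_mono: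
  assumes "list_all2 (\<le>) u v"
  shows "list_encode u \<le> list_encode v"
  using assms by induction (auto intro: prod_encode_mono)

text \<open>For given \<open>i\<close>, search for a length \<open>s\<close> such that all lists
  below \<open>g\<close> that pass the first \<open>s\<close> conditions agree at \<open>i\<close>.
  Compactness makes the search end. As \<open>g\<close> dominates \<open>w\<close>, the initial
  segment of \<open>w\<close> is among these lists, so the common value is
  \<open>w i\<close>.\<close>

lemma computable_on_unique_path:
  assumes closed: "closed_class C"
    and dec: "decidable_on S (\<lambda>X m. C (look (p1 m)) (p2 m))"
    and w: "path C w" and unique: "\<And>f. path C f \<Longrightarrow> f = w"
    and g: "computable_on S g" and bound: "\<And>X j. X \<in> S \<Longrightarrow> w j \<le> g X j"
  shows "computable_on S (\<lambda>X i. w i)"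
proof -
  \<comment> \<open>The code of the list of the first \<open>s\<close> bounds, consed from the last
    to the first. List codes are monotone entrywise, so it bounds the codes of all lists to be
    tested.\<close>
  define M where "M X s = rec_nat 0 (\<lambda>j e. Suc (prod_encode (g X (s - Suc j), e))) s" for X s
  have M: "M X s = list_encode (map (g X) [0..<s])" for X s
  proof -
    have "rec_nat 0 (\<lambda>j e. Suc (prod_encode (g X (s - Suc j), e))) k = list_encode (map (g X) [s - k..<s])"
      if "k \<le> s" for k
      using that
    proof (induction k)
      case (Suc k)
      have "[s - Suc k..<s] = (s - Suc k) # [s - k..<s]"
        using Suc.prems by (subst upt_conv_Cons) (auto simp: Suc_diff_Suc)
      then show ?case using Suc by simp
    qed simp
    from this[of s] show ?thesis by (simp add: M_def)
  qed
  \<comment> \<open>\<open>z\<close> packs a length and a proposed value. A zero at that length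
    after nonzero lookups says that \<open>u\<close> codes a list of exactly this length.\<close>
  define T where "T X i z \<longleftrightarrow> i < p1 z \<and>
    (\<forall>u<Suc (M X (p1 z)). (look u (p1 z) = 0 \<and>
       (\<forall>j<p1 z. \<not> look u j = 0 \<and> look u j \<le> Suc (g X j)) \<and> (\<forall>l<p1 z. C (look u) l)) \<longrightarrow>
       look u i = Suc (p2 z))" for X i z
  have decT: "decidable_on S (\<lambda>X m. T X (p1 m) (p2 m))"
    unfolding T_def M_def
    by (intro computable_intros computable_on_rec_nat computable_on_look computable_on_compose[OF g]
        computable_on_compose2[OF dec])
  have ex: "\<exists>z. T X i z" for X i
  proof -
    obtain s where s: "i < s" "\<And>u. length u = s \<Longrightarrow> (\<forall>j<s. u ! j \<le> g X j) \<Longrightarrow>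
        (\<forall>l<s. C (look_list u) l) \<Longrightarrow> u ! i = w i"
      using unique_path_compactness[OF closed unique, of i "g X"] by blast
    have "T X i (prod_encode (s, w i))"
      unfolding T_def fst_conv snd_conv prod_encode_inverse
    proof (intro conjI allI impI s(1), elim conjE)
      fix u
      assume u: "look u s = 0" "\<forall>j<s. \<not> look u j = 0 \<and> look u j \<le> Suc (g X j)" "\<forall>l<s. C (look u) l"
      define v where "v = list_decode u"
      have look: "look u = look_list v" by (simp add: v_def look_list_encode[symmetric])
      have "length v = s"
        using u(1) u(2)[rule_format, of "length v"] unfolding look look_list_def
        by (auto split: if_splits) (meson linorder_neqE_nat)
      with u s(1) s(2)[of v] show "look u i = Suc (w i)"
        unfolding look by (auto simp: look_list_def)
    qed
    then show ?thesis ..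
  qed
  have T: "p2 z = w i" if "X \<in> S" "T X i z" for X i z
  proof -
    define s where "s = p1 z"
    define u where "u = list_encode (map w [0..<s])"
    have "u \<le> M X s"
      unfolding u_def M using bound[OF that(1)] by (intro list_encode_mono) (auto simp: list_all2_conv_all_nth)
    moreover have "C (look u) l" for l
      using w closed_class_antimono[OF closed partial_le_initial] unfolding path_def u_def by simp
    moreover have "look u j = (if j < s then Suc (w j) else 0)" for j
      by (simp add: u_def initial_eq)
    moreover have "i < s" "u < Suc (M X s) \<Longrightarrow> look u s = 0 \<and>
       (\<forall>j<s. \<not> look u j = 0 \<and> look u j \<le> Suc (g X j)) \<and> (\<forall>l<s. C (look u) l) \<Longrightarrow>
       look u i = Suc (p2 z)"
      using that(2) unfolding T_def s_def by blast+
    ultimately have "look u i = Suc (p2 z)" "i < s"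
      using bound[OF that(1)] by (simp_all add: less_Suc_eq_le)
    then show ?thesis by (simp add: u_def initial_eq)
  qed
  have "computable_on S (\<lambda>X i. p2 (LEAST z. T X i z))"
    by (intro computable_on_p2 computable_on_Least decT ex)
  then show ?thesis
    by (rule computable_on_cong) (rule T, assumption, rule LeastI_ex[OF ex])
qed

section \<open>Evaluation tables\<close>

text \<open>Row \<open>0\<close> of a table records which numbers are programs, so that this too is
  governed by local conditions. Row \<open>Suc b\<close> records the computations relative to oracle
  number \<open>b\<close>.\<close>

abbreviation flag_index :: "nat \<Rightarrow> nat" where
  "flag_index e \<equiv> prod_encode (0, e)"

abbreviation eval_index :: "nat \<Rightarrow> nat \<Rightarrow> nat \<Rightarrow> nat" where
  "eval_index b e n \<equiv> prod_encode (Suc b, prod_encode (e, n))"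

fun option_value :: "nat option \<Rightarrow> nat" where
  "option_value None = 0"
| "option_value (Some v) = Suc v"

lemma option_value_simps [simp]:
  "option_value x = 0 \<longleftrightarrow> x = None" "0 < option_value x \<longleftrightarrow> x \<noteq> None"
  "option_value x = Suc v \<longleftrightarrow> x = Some v" "Suc v = option_value x \<longleftrightarrow> x = Some v"
  by (cases x; auto)+

definition eval_table :: "(nat \<Rightarrow> nat set) \<Rightarrow> nat \<Rightarrow> nat" where
  "eval_table Y i =
     (if p1 i = 0 then of_bool (p2 i \<in> range code_num)
      else if p1 (p2 i) \<in> range code_num
      then option_value (run (Y (p1 i - 1)) (inv code_num (p1 (p2 i))) (p2 (p2 i)))
      else 0)"

lemma inv_code_num [simp]: "inv code_num (code_num c) = c"
  by (rule inv_f_f) (simp add: inj_def code_num_inject)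

lemma eval_table_simps [simp]:
  "eval_table Y (flag_index e) = of_bool (e \<in> range code_num)"
  "eval_table Y (eval_index b (code_num c) n) = option_value (run (Y b) c n)"
  "e \<notin> range code_num \<Longrightarrow> eval_table Y (eval_index b e n) = 0"
  by (simp_all add: eval_table_def)

text \<open>Entries are shifted by one: \<open>2\<close> says that \<open>e\<close> is the number of
  a program, \<open>1\<close> that it is not, and \<open>0\<close> that the flags of its components
  are not yet known.\<close>

definition expected_flag :: "(nat \<Rightarrow> nat) \<Rightarrow> nat \<Rightarrow> nat" where
  "expected_flag G e =
     (let a = p1 e; y = p2 e; u = G (flag_index (p1 y)); v = G (flag_index (p2 y)) in
      if a \<le> 4 then if y = 0 then 2 else 1
      else if a \<le> 7 then if u = 0 \<or> v = 0 then 0 else if u = 2 \<and> v = 2 then 2 else 1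
      else if a = 8 then G (flag_index y) else 1)"

text \<open>What the outermost constructor of \<open>e\<close> forces: \<open>0\<close> if needed
  entries are missing, \<open>1\<close> for divergence, \<open>v + 2\<close> for the result
  \<open>v\<close>. Membership in oracle \<open>b\<close> is expressed by \<open>t\<close> together
  with a nonzero table entry at \<open>r b n\<close>. The last branch is \<open>Prec\<close>;
  \<open>Mu\<close> is left to \<open>mu_condition\<close>.\<close>

definition expected_value ::
    "(nat \<Rightarrow> nat \<Rightarrow> bool) \<Rightarrow> (nat \<Rightarrow> nat \<Rightarrow> nat) \<Rightarrow> (nat \<Rightarrow> nat) \<Rightarrow> nat \<Rightarrow> nat \<Rightarrow> nat \<Rightarrow> nat" where
  "expected_value t r G b e n =
     (let a = p1 e; f = p1 (p2 e); g = p2 (p2 e) in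
      if a = 0 then 2
      else if a = 1 then Suc (Suc (Suc n))
      else if a = 2 then Suc (Suc (p1 n))
      else if a = 3 then Suc (Suc (p2 n))
      else if a = 4 then if G (r b n) = 0 then 0 else if t b n \<and> \<not> G (r b n) = 1 then 3 else 2
      else if a = 5 then
        let u = G (eval_index b f n); v = G (eval_index b g n) in
        if u = 0 \<or> v = 0 then 0 else if u = 1 \<or> v = 1 then 1
        else Suc (Suc (prod_encode (u - 2, v - 2)))
      else if a = 6 then
        let u = G (eval_index b g n) in if u \<le> 1 then u else G (eval_index b f (u - 2))
      else if p2 n = 0 then G (eval_index b f (p1 n))
      else
        let u = G (eval_index b e (prod_encode (p1 n, p2 n - 1))) in
        if u \<le> 1 then u
        else G (eval_index b g (prod_encode (p1 n, prod_encode (p2 n - 1, u - 2)))))"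

text \<open>Divergence of a minimization concerns all \<open>k\<close>, so it is split into one
  finite condition for each \<open>k\<close>. Here \<open>v\<close> is the shifted entry: if it is
  \<open>1\<close>, then \<open>k\<close> must not be seen to be the first zero; otherwise
  \<open>v - 2\<close> must be the first zero as far as entries are known.\<close>

definition mu_condition :: "(nat \<Rightarrow> nat) \<Rightarrow> nat \<Rightarrow> nat \<Rightarrow> nat \<Rightarrow> nat \<Rightarrow> nat \<Rightarrow> bool" where
  "mu_condition G b f n v k \<longleftrightarrow>
     (if v = 1
      then \<not> (G (eval_index b f (prod_encode (n, k))) = 2 \<and>
              (\<forall>j<k. 3 \<le> G (eval_index b f (prod_encode (n, j)))))
      else (G (eval_index b f (prod_encode (n, v - 2))) = 0 \<or>
            G (eval_index b f (prod_encode (n, v - 2))) = 2) \<and>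
           (\<forall>j<v - 2. G (eval_index b f (prod_encode (n, j))) = 0 \<or>
                        3 \<le> G (eval_index b f (prod_encode (n, j)))))"

text \<open>
  \<open>G\<close> is a partial table: the value \<open>0\<close> means "not yet known" and \<open>Suc v\<close> stands for the entry
  \<open>v\<close> of \<^const>\<open>eval_table\<close>, which in turn is \<open>0\<close> for divergence. The oracle number \<open>b\<close>
  may itself be described by entries of the table, through \<open>t\<close> and \<open>r\<close>.
\<close>

definition table_condition ::
    "(nat \<Rightarrow> nat \<Rightarrow> bool) \<Rightarrow> (nat \<Rightarrow> nat \<Rightarrow> nat) \<Rightarrow> (nat \<Rightarrow> nat) \<Rightarrow> nat \<Rightarrow> bool" where
  "table_condition t r G i \<longleftrightarrow>
     (let b = p1 (p1 i); y = p2 (p1 i); e = p1 y; n = p2 y; k = p2 i in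
      if b = 0
      then G (flag_index y) = 0 \<or> expected_flag G y = 0 \<or> G (flag_index y) = expected_flag G y
      else G (eval_index (b - 1) e n) = 0 \<or> G (flag_index e) = 0 \<or>
        (if G (flag_index e) = 1 then G (eval_index (b - 1) e n) = 1
         else if p1 e = 8 then mu_condition G (b - 1) (p2 e) n (G (eval_index (b - 1) e n)) k
         else expected_value t r G (b - 1) e n = 0 \<or>
           G (eval_index (b - 1) e n) = expected_value t r G (b - 1) e n))"

section \<open>Monotonicity and locality of the table conditions\<close>

lemma expected_flag_mono:
  assumes "partial_le G G'"
  shows "expected_flag G e = 0 \<or> expected_flag G e = expected_flag G' e"
proof -
  have le: "G j = 0 \<or> G j = G' j" for j using assms by (simp add: partial_le_def)
  show ?thesis
    using le[of "flag_index (p1 (p2 e))"] le[of "flag_index (p2 (p2 e))"] le[of "flag_index (p2 e)"]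
    by (auto simp: expected_flag_def Let_def)
qed

lemma expected_value_mono:
  assumes "partial_le G G'"
  shows "expected_value t r G b e n = 0 \<or> expected_value t r G b e n = expected_value t r G' b e n"
proof -
  have le: "G j = 0 \<or> G j = G' j" for j using assms by (simp add: partial_le_def)
  consider "p1 e \<le> 3" | "p1 e = 4" | "p1 e = 5" | "p1 e = 6" | "p1 e \<ge> 7" by linarith
  then show ?thesis
  proof cases
    case 1
    then show ?thesis by (simp add: expected_value_def Let_def)
  next
    case 2
    then show ?thesis using le[of "r b n"] by (auto simp: expected_value_def Let_def)
  next
    case 3
    then show ?thesis
      using le[of "eval_index b (p1 (p2 e)) n"] le[of "eval_index b (p2 (p2 e)) n"]
      by (auto simp: expected_value_def Let_def)
  next
    case 4
    then show ?thesis
      using le[of "eval_index b (p2 (p2 e)) n"]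
        le[of "eval_index b (p1 (p2 e)) (G (eval_index b (p2 (p2 e)) n) - 2)"]
      by (auto simp: expected_value_def Let_def)
  next
    case 5
    then show ?thesis
      using le[of "eval_index b (p1 (p2 e)) (p1 n)"] le[of "eval_index b e (prod_encode (p1 n, p2 n - 1))"]
        le[of "eval_index b (p2 (p2 e)) (prod_encode (p1 n, prod_encode (p2 n - 1,
          G (eval_index b e (prod_encode (p1 n, p2 n - 1))) - 2)))"]
      by (auto simp: expected_value_def Let_def)
  qed
qed

lemma mu_condition_antimono:
  assumes "partial_le G G'" "mu_condition G' b f n v k"
  shows "mu_condition G b f n v k"
proof -
  have le: "G j = 0 \<or> G j = G' j" for j using assms by (simp add: partial_le_def)
  show ?thesis
  proof (cases "v = 1")
    case True
    have "3 \<le> G' j" if "3 \<le> G j" for j using le[of j] that by auto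
    moreover have "G' j = 2" if "G j = 2" for j using le[of j] that by auto
    ultimately show ?thesis using assms(2) True unfolding mu_condition_def by (simp add: Let_def) blast
  next
    case False
    then show ?thesis using assms(2) unfolding mu_condition_def by (simp, metis le)
  qed
qed

lemma initial_eventually: "eventually (\<lambda>L. initial f L j = Suc (f j)) sequentially"
  using eventually_gt_at_top[of j] by eventually_elim (simp add: initial_eq)

lemma expected_flag_limit:
  "eventually (\<lambda>L. expected_flag (initial f L) e = expected_flag (\<lambda>j. Suc (f j)) e) sequentially"
proof -
  have "eventually (\<lambda>L. \<forall>j\<in>{flag_index (p1 (p2 e)), flag_index (p2 (p2 e)), flag_index (p2 e)}.
      initial f L j = Suc (f j)) sequentially"
    by (intro eventually_ball_finite ballI initial_eventually) simp
  then show ?thesis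
    by eventually_elim (simp add: expected_flag_def Let_def)
qed

lemma expected_value_limit:
  "eventually (\<lambda>L. expected_value t r (initial f L) b e n = expected_value t r (\<lambda>j. Suc (f j)) b e n) sequentially"
proof -
  \<comment> \<open>Some indices depend on other entries, as in composition and recursion. They are
    computed from the limit \<open>f\<close>, so the nested lookups agree once the inner ones
    do.\<close>
  have "eventually (\<lambda>L. \<forall>j\<in>{r b n, eval_index b (p1 (p2 e)) n, eval_index b (p2 (p2 e)) n,
       eval_index b (p1 (p2 e)) (Suc (f (eval_index b (p2 (p2 e)) n)) - 2),
       eval_index b (p1 (p2 e)) (p1 n), eval_index b e (prod_encode (p1 n, p2 n - 1)),
       eval_index b (p2 (p2 e)) (prod_encode (p1 n, prod_encode (p2 n - 1,
          Suc (f (eval_index b e (prod_encode (p1 n, p2 n - 1)))) - 2)))}.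
      initial f L j = Suc (f j)) sequentially"
    by (intro eventually_ball_finite ballI initial_eventually) simp
  then show ?thesis
    by eventually_elim (simp add: expected_value_def Let_def)
qed

lemma mu_condition_limit:
  "eventually (\<lambda>L. mu_condition (initial f L) b g n v k = mu_condition (\<lambda>j. Suc (f j)) b g n v k) sequentially"
proof -
  have "eventually (\<lambda>L. \<forall>j\<in>(\<lambda>i. eval_index b g (prod_encode (n, i))) ` {..k + (v - 2)}.
      initial f L j = Suc (f j)) sequentially"
    by (intro eventually_ball_finite ballI initial_eventually) simp
  then show ?thesis
  proof eventually_elim
    case (elim L)
    then have "initial f L (eval_index b g (prod_encode (n, i))) = Suc (f (eval_index b g (prod_encode (n, i))))"
      if "i \<le> k + (v - 2)" for i
      using that by blast
    then show ?case unfolding mu_condition_def by simp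
  qed
qed

lemma closed_class_table_condition: "closed_class (table_condition t r)"
  unfolding closed_class_def
proof (intro conjI allI impI)
  fix G G' i
  assume le: "partial_le G G'" and C: "table_condition t r G' i"
  have eq: "G j = 0 \<or> G j = G' j" for j using le by (simp add: partial_le_def)
  define b where "b = p1 (p1 i)"
  define y where "y = p2 (p1 i)"
  show "table_condition t r G i"
  proof (cases "b = 0")
    case True
    then show ?thesis
      using C eq[of "flag_index y"] expected_flag_mono[OF le, of y]
      unfolding table_condition_def Let_def b_def[symmetric] y_def[symmetric] by auto
  next
    case False
    then show ?thesis
      using C eq[of "flag_index (p1 y)"] eq[of "eval_index (b - 1) (p1 y) (p2 y)"]
        expected_value_mono[OF le, of t r "b - 1" "p1 y" "p2 y"]
        mu_condition_antimono[OF le, of "b - 1" "p2 (p1 y)" "p2 y" "G (eval_index (b - 1) (p1 y) (p2 y))" "p2 i"]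
      unfolding table_condition_def Let_def b_def[symmetric] y_def[symmetric]
      by (auto split: if_splits)
  qed
next
  fix f i
  assume C: "\<forall>L. table_condition t r (initial f L) i"
  define b where "b = p1 (p1 i)"
  define y where "y = p2 (p1 i)"
  have "eventually (\<lambda>L. table_condition t r (initial f L) i = table_condition t r (\<lambda>j. Suc (f j)) i) sequentially"
    using initial_eventually[of f "flag_index y"] initial_eventually[of f "flag_index (p1 y)"]
      initial_eventually[of f "eval_index (b - 1) (p1 y) (p2 y)"] expected_flag_limit[of f y]
      expected_value_limit[of t r f "b - 1" "p1 y" "p2 y"]
      mu_condition_limit[of f "b - 1" "p2 (p1 y)" "p2 y" "Suc (f (eval_index (b - 1) (p1 y) (p2 y)))" "p2 i"]
    unfolding table_condition_def Let_def b_def[symmetric] y_def[symmetric]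
    by eventually_elim (simp only:)
  then obtain L where "table_condition t r (initial f L) i = table_condition t r (\<lambda>j. Suc (f j)) i"
    using eventually_happens trivial_limit_sequentially by blast
  with C show "table_condition t r (\<lambda>j. Suc (f j)) i" by blast
qed

lemma decidable_on_table_condition:
  assumes t: "decidable_on S (\<lambda>X m. t (p1 m) (p2 m))"
    and r: "computable_on S (\<lambda>X m. r (p1 m) (p2 m))"
    and G: "computable_on S (\<lambda>X m. G X (p1 m) (p2 m))"
  shows "decidable_on S (\<lambda>X m. table_condition t r (G X (p1 m)) (p2 m))"
  unfolding table_condition_def expected_flag_def expected_value_def mu_condition_def Let_def
  by (intro computable_intros computable_on_compose2[OF t] computable_on_compose2[OF r] computable_on_compose2[OF G])

section \<open>The true table as the only path\<close>

lemma mem_range_code_num_iff: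
  "e \<in> range code_num \<longleftrightarrow>
     p1 e \<le> 4 \<and> p2 e = 0 \<or>
     4 < p1 e \<and> p1 e \<le> 7 \<and> p1 (p2 e) \<in> range code_num \<and> p2 (p2 e) \<in> range code_num \<or>
     p1 e = 8 \<and> p2 e \<in> range code_num" (is "_ \<longleftrightarrow> ?R")
proof
  assume "e \<in> range code_num"
  then obtain c where "e = code_num c" by blast
  then show ?R by (cases c) auto
next
  assume R: ?R
  have e: "e = prod_encode (p1 e, p2 e)" by simp
  have y: "p2 e = prod_encode (p1 (p2 e), p2 (p2 e))" by simp
  from R consider "p2 e = 0" "p1 e \<le> 4"
    | c d where "p1 e \<in> {5, 6, 7}" "p1 (p2 e) = code_num c" "p2 (p2 e) = code_num d"
    | c where "p1 e = 8" "p2 e = code_num c"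
    by fastforce
  then show "e \<in> range code_num"
  proof cases
    case 1
    then have "p1 e = 0 \<or> p1 e = 1 \<or> p1 e = 2 \<or> p1 e = 3 \<or> p1 e = 4" by linarith
    then have "e = code_num Zero \<or> e = code_num Succ \<or> e = code_num Fst \<or> e = code_num Snd \<or> e = code_num Oracle"
      using 1(1) e by (auto simp del: prod_decode_inverse prod.collapse)
    then show ?thesis by blast
  next
    case (2 c d)
    then have "e = code_num (Pair c d) \<or> e = code_num (Comp c d) \<or> e = code_num (Prec c d)"
      using e y by (auto simp del: prod_decode_inverse prod.collapse)
    then show ?thesis by blast
  next
    case (3 c)
    then have "e = code_num (Mu c)" using e by simp
    then show ?thesis by blast
  qed
qed


lemma expected_flag_eq:
  assumes "\<And>e'. e' < e \<Longrightarrow> G (flag_index e') = Suc (of_bool (e' \<in> range code_num))"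
  shows "expected_flag G e = Suc (of_bool (e \<in> range code_num))"
proof -
  have e: "prod_encode (p1 e, p2 e) = e" by simp
  \<comment> \<open>A positive tag makes the second component strictly smaller than
    \<open>e\<close>, so the hypothesis covers the flags of all components.\<close>
  have "triangle (p1 e + p2 e) + p1 e = e"
    using e unfolding prod_encode_def by (simp del: prod_decode_inverse prod.collapse)
  moreover have "n \<le> triangle n" for n by (induction n) auto
  ultimately have less: "p2 e < e" if "p1 e > 4"
    using that by (metis add.commute add_leD2 add_less_same_cancel1 le_eq_less_or_eq less_add_same_cancel1 not_gr_zero not_less_zero order_less_le_trans)
  have le: "p1 (p2 e) \<le> p2 e" "p2 (p2 e) \<le> p2 e"
    using le_prod_encode_1[of "p1 (p2 e)" "p2 (p2 e)"] le_prod_encode_2[of "p2 (p2 e)" "p1 (p2 e)"] by simp_all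
  have G: "G (flag_index e') = Suc (of_bool (e' \<in> range code_num))"
    if "p1 e > 4" "e' \<in> {p1 (p2 e), p2 (p2 e), p2 e}" for e'
    using assms[of e'] less[OF that(1)] le that(2) by auto
  show ?thesis
    unfolding expected_flag_def Let_def using mem_range_code_num_iff[of e] G
    by (cases "p1 e > 4") auto
qed

lemma run_Prec_unfold:
  "run X (Prec f g) n =
     (if p2 n = 0 then run X f (p1 n)
      else Option.bind (run X (Prec f g) (prod_encode (p1 n, p2 n - 1)))
        (\<lambda>v. run X g (prod_encode (p1 n, prod_encode (p2 n - 1, v)))))"
  by (cases "p2 n") (simp_all add: case_prod_beta)

lemma run_Mu_eq_Some_iff:
  "run X (Mu f) n = Some v \<longleftrightarrow>
     run X f (prod_encode (n, v)) = Some 0 \<and> (\<forall>j<v. \<exists>u>0. run X f (prod_encode (n, j)) = Some u)"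
    (is "_ \<longleftrightarrow> ?Z v")
proof -
  have least: "(LEAST k. ?Z k) = k" if "?Z k" for k
  proof (rule Least_equality)
    show "k \<le> l" if "?Z l" for l
    proof (rule ccontr)
      assume "\<not> k \<le> l"
      then have "\<exists>u>0. run X f (prod_encode (n, l)) = Some u" using \<open>?Z k\<close> by auto
      with \<open>?Z l\<close> show False by auto
    qed
  qed (use that in simp_all)
  have "run X (Mu f) n = (if \<exists>k. ?Z k then Some (LEAST k. ?Z k) else None)"
    by (simp only: run.simps Let_def)
  moreover have "(LEAST k. ?Z k) = v \<and> (\<exists>k. ?Z k) \<longleftrightarrow> ?Z v"
    using least by blast
  ultimately show ?thesis by auto
qed

definition table_ok :: "nat set \<Rightarrow> (nat \<Rightarrow> nat) \<Rightarrow> nat \<Rightarrow> code \<Rightarrow> nat \<Rightarrow> bool" where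
  "table_ok X G b c n \<longleftrightarrow> G (eval_index b (code_num c) n) = Suc (option_value (run X c n))"

text \<open>The inductive step common to existence and uniqueness of the table. Only
  \<open>Prec\<close> refers back to its own program, at a smaller counter, hence the assumption
  \<open>pred\<close>.\<close>

lemma expected_value_code:
  assumes query: "\<And>n. G (r b n) \<noteq> 0" "\<And>n. n \<in> X \<longleftrightarrow> t b n \<and> G (r b n) \<noteq> 1"
    and sub: "\<And>d m. size d < size c \<Longrightarrow> table_ok X G b d m"
    and pred: "0 < p2 n \<Longrightarrow> table_ok X G b c (prod_encode (p1 n, p2 n - 1))"
    and "\<And>d. c \<noteq> Mu d"
  shows "expected_value t r G b (code_num c) n = Suc (option_value (run X c n))"
proof (cases c)
  case Oracle
  then show ?thesis using query by (simp add: expected_value_def)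
next
  case (Pair f g)
  then have "table_ok X G b f n" "table_ok X G b g n" by (simp_all add: sub)
  with Pair show ?thesis
    by (cases "run X f n"; cases "run X g n") (simp_all add: expected_value_def table_ok_def Let_def)
next
  case (Comp f g)
  then have "table_ok X G b f m" "table_ok X G b g m" for m by (simp_all add: sub)
  with Comp show ?thesis
    by (cases "run X g n") (simp_all add: expected_value_def table_ok_def Let_def)
next
  case (Prec f g)
  then have ok: "table_ok X G b f m" "table_ok X G b g m" for m by (simp_all add: sub)
  show ?thesis
  proof (cases "p2 n = 0")
    case True
    then show ?thesis
      using ok Prec unfolding run_Prec_unfold[of X f g n] Prec
      by (simp add: expected_value_def table_ok_def Let_def)
  next
    case False
    then show ?thesis
      using ok pred unfolding run_Prec_unfold[of X f g n] Prec
      by (cases "run X (Prec f g) (prod_encode (p1 n, p2 n - 1))")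
        (simp_all add: expected_value_def table_ok_def Let_def del: run.simps)
  qed
qed (use assms(5) in \<open>simp_all add: expected_value_def\<close>)

text \<open>Taken over all \<open>k\<close>, the finite conditions pin down the entry:
  \<open>v = 0\<close> excludes a first zero, and any other \<open>v\<close> names
  \<open>v - 1\<close> as the first zero.\<close>

lemma mu_condition_code:
  assumes "\<And>m. table_ok X G b f m"
  shows "(\<forall>k. mu_condition G b (code_num f) n (Suc v) k) \<longleftrightarrow> option_value (run X (Mu f) n) = v"
proof -
  have G: "G (eval_index b (code_num f) m) = Suc (option_value (run X f m))" for m
    using assms by (simp add: table_ok_def)
  have "3 \<le> Suc (option_value x) \<longleftrightarrow> (\<exists>u>0. x = Some u)" for x
    by (cases x) auto
  then have "(\<forall>k. mu_condition G b (code_num f) n (Suc v) k) \<longleftrightarrow>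
      (if v = 0 then \<forall>k. run X (Mu f) n \<noteq> Some k else run X (Mu f) n = Some (v - 1))"
    unfolding mu_condition_def run_Mu_eq_Some_iff by (simp add: G del: run.simps)
  then show ?thesis by (cases v) (auto simp del: run.simps)
qed

lemma path_table_flag:
  assumes "path (table_condition t r) f"
  shows "f (flag_index e) = of_bool (e \<in> range code_num)"
proof (induction e rule: less_induct)
  case (less e)
  let ?G = "\<lambda>j. Suc (f j)"
  have "table_condition t r ?G (prod_encode (flag_index e, 0))"
    using assms unfolding path_def by blast
  then show ?case
    using expected_flag_eq[of e ?G] less by (simp add: table_condition_def)
qed

text \<open>Once the oracle queries are settled no entry is free: induction on the size of the
  program and, for a fixed program, on the recursion counter.\<close>

lemma path_table_value:
  assumes path: "path (table_condition t r) f"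
    and query: "\<And>n. n \<in> X \<longleftrightarrow> t b n \<and> f (r b n) \<noteq> 0"
  shows "f (eval_index b (code_num c) n) = option_value (run X c n)"
proof -
  let ?G = "\<lambda>j. Suc (f j)"
  have cond: "table_condition t r ?G (prod_encode (eval_index b (code_num c) n, k))" for c n k
    using path unfolding path_def by blast
  have flag: "f (flag_index (code_num c)) = 1" for c
    using path_table_flag[OF path] by simp
  have "table_ok X ?G b c n"
  proof (induction c arbitrary: n rule: measure_induct_rule[of size])
    case (less c)
    note IH = this
    show ?case
    proof (cases "\<exists>d. c = Mu d")
      case True
      then obtain d where c: "c = Mu d" by blast
      then have "\<And>m. table_ok X ?G b d m" using IH by simp
      moreover have "\<forall>k. mu_condition ?G b (code_num d) n (?G (eval_index b (code_num c) n)) k"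
        using cond[of c n] flag[of c] c by (simp add: table_condition_def)
      ultimately have "option_value (run X (Mu d) n) = f (eval_index b (code_num c) n)"
        using mu_condition_code[of X ?G b d n "f (eval_index b (code_num c) n)"] by blast
      then show ?thesis by (simp only: c table_ok_def)
    next
      case False
      have "p1 (code_num c) \<noteq> 8" using False by (cases c) auto
      then have *: "expected_value t r ?G b (code_num c) n = 0 \<or>
          ?G (eval_index b (code_num c) n) = expected_value t r ?G b (code_num c) n" for n
        using cond[of c n] flag[of c] by (simp add: table_condition_def Let_def)
      show ?thesis
      proof (induction "p2 n" arbitrary: n rule: less_induct)
        case less
        have "expected_value t r ?G b (code_num c) n = Suc (option_value (run X c n))"
          using False IH less query by (intro expected_value_code) auto
        with * show ?case unfolding table_ok_def by (metis nat.distinct(1))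
      qed
    qed
  qed
  then show ?thesis by (simp add: table_ok_def)
qed

lemma path_table_not_code:
  assumes "path (table_condition t r) f" "e \<notin> range code_num"
  shows "f (eval_index b e n) = 0"
proof -
  have "table_condition t r (\<lambda>j. Suc (f j)) (prod_encode (eval_index b e n, 0))"
    using assms(1) unfolding path_def by blast
  then show ?thesis
    using path_table_flag[OF assms(1), of e] assms(2) by (simp add: table_condition_def)
qed

lemma path_eval_table:
  assumes query: "\<And>b n. n \<in> Y b \<longleftrightarrow> t b n \<and> eval_table Y (r b n) \<noteq> 0"
  shows "path (table_condition t r) (eval_table Y)"
  unfolding path_def
proof
  fix i
  let ?G = "\<lambda>j. Suc (eval_table Y j)"
  have ok: "table_ok (Y b) ?G b c n" for b c n by (simp add: table_ok_def)
  obtain b y k where i: "i = prod_encode (prod_encode (b, y), k)"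
    by (metis prod.exhaust prod_decode_inverse)
  show "table_condition t r ?G i"
  proof (cases b)
    case 0
    then show ?thesis
      using expected_flag_eq[of y ?G] by (simp add: table_condition_def i)
  next
    case (Suc b')
    obtain e n where y: "y = prod_encode (e, n)" by (metis prod.exhaust prod_decode_inverse)
    show ?thesis
    proof (cases "e \<in> range code_num")
      case False
      then show ?thesis by (simp add: table_condition_def i Suc y)
    next
      case True
      then obtain c where e: "e = code_num c" by blast
      show ?thesis
      proof (cases "\<exists>d. c = Mu d")
        case True
        then obtain d where "c = Mu d" by blast
        moreover have "mu_condition ?G b' (code_num d) n (Suc (option_value (run (Y b') (Mu d) n))) k"
          using mu_condition_code[OF ok] by blast
        ultimately show ?thesis
          by (simp add: table_condition_def i Suc y e del: run.simps)
            (simp flip: code_num.simps del: run.simps)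
      next
        case False
        then have "expected_value t r ?G b' (code_num c) n = Suc (option_value (run (Y b') c n))"
          using query by (intro expected_value_code) (auto simp: ok)
        moreover have "p1 (code_num c) \<noteq> 8" using False by (cases c) auto
        ultimately show ?thesis
          by (simp add: table_condition_def i Suc y e)
      qed
    qed
  qed
qed

text \<open>Queries to oracle \<open>b\<close> are answered by rows of oracles
  \<open>W\<close>-below \<open>b\<close>, so well-founded induction fixes one row after the
  other.\<close>

lemma path_table_unique:
  assumes wf: "wf W" and path: "path (table_condition t r) f"
    and query: "\<And>b n. n \<in> Y b \<longleftrightarrow> t b n \<and> eval_table Y (r b n) \<noteq> 0"
    and r: "\<And>b n. t b n \<Longrightarrow> \<exists>b' e m. r b n = eval_index b' e m \<and> (b', b) \<in> W"
  shows "f = eval_table Y"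
proof -
  have eval: "f (eval_index b e n) = eval_table Y (eval_index b e n)" for b e n
    using wf
  proof (induction b arbitrary: e n)
    case (less b)
    have X: "n \<in> Y b \<longleftrightarrow> t b n \<and> f (r b n) \<noteq> 0" for n
      using query[of n b] r[of b n] less by fastforce
    show ?case
    proof (cases "e \<in> range code_num")
      case True
      then show ?thesis using path_table_value[OF path X] by auto
    next
      case False
      then show ?thesis using path_table_not_code[OF path] by simp
    qed
  qed
  show ?thesis
  proof
    fix i
    obtain b y where i: "i = prod_encode (b, y)" by (metis prod.exhaust prod_decode_inverse)
    obtain e n where y: "y = prod_encode (e, n)" by (metis prod.exhaust prod_decode_inverse)
    show "f i = eval_table Y i"
      using eval path_table_flag[OF path] by (cases b) (simp_all add: i y)
  qed
qed

section \<open>Sets of density one\<close>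

text \<open>Trades the limit for integer inequalities: the complement eventually has proportion at
  most \<open>1 / k\<close>. The witnesses \<open>h\<close> can then be collected into a
  modulus.\<close>

lemma density_one_iff:
  "density_one A \<longleftrightarrow> (\<forall>k. \<exists>h. \<forall>N\<ge>h. k * card ({..<N} - A) \<le> N)"
proof -
  have card: "card (A \<inter> {..<N}) + card ({..<N} - A) = N" for N
    using card_Int_Diff[of "{..<N}" A] by (simp add: Int_commute)
  then have real: "real (card (A \<inter> {..<N})) = real N - real (card ({..<N} - A))" for N
    by (metis add_diff_cancel_right' of_nat_add)
  have dist: "norm (real (card (A \<inter> {..<N})) / real N - 1) = real (card ({..<N} - A)) / real N"
    if "N > 0" for N
    using that by (simp add: real field_simps)
  show ?thesis
    unfolding density_one_def LIMSEQ_iff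
  proof (intro iffI allI impI)
    fix k :: nat
    assume "\<forall>r>0. \<exists>no. \<forall>n\<ge>no. norm (real (card (A \<inter> {..<n})) / real n - 1) < r"
    then obtain h where h: "\<And>n. n \<ge> h \<Longrightarrow> norm (real (card (A \<inter> {..<n})) / real n - 1) < 1 / (k + 1)"
      by (metis of_nat_0_less_iff zero_less_divide_1_iff add_gr_0 zero_less_one)
    have "k * card ({..<N} - A) \<le> N" if "N \<ge> Suc h" for N
    proof -
      have "real (card ({..<N} - A)) / real N < 1 / (k + 1)"
        using h[of N] dist[of N] that by simp
      then have "(real k + 1) * real (card ({..<N} - A)) < real N"
        using that by (simp add: field_simps)
      then have "real (k * card ({..<N} - A)) \<le> real N"
        by (simp add: algebra_simps)
      then show ?thesis by (simp only: of_nat_le_iff)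
    qed
    then show "\<exists>h. \<forall>N\<ge>h. k * card ({..<N} - A) \<le> N" by blast
  next
    fix r :: real
    assume *: "\<forall>k. \<exists>h. \<forall>N\<ge>h. k * card ({..<N} - A) \<le> N" and "r > 0"
    obtain k :: nat where k: "1 / r < real k" using reals_Archimedean2 by blast
    then have "k > 0" using \<open>r > 0\<close> by (metis gr0I less_asym of_nat_0 zero_less_divide_1_iff)
    obtain h where h: "\<And>N. N \<ge> h \<Longrightarrow> k * card ({..<N} - A) \<le> N" using * by blast
    have "norm (real (card (A \<inter> {..<N})) / real N - 1) < r" if "N \<ge> Suc h" for N
    proof -
      have "real k * real (card ({..<N} - A)) \<le> real N"
        using h[of N] that by (simp flip: of_nat_mult)
      then have "real (card ({..<N} - A)) / real N \<le> 1 / real k"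
        using that \<open>k > 0\<close> by (simp add: field_simps)
      also have "\<dots> < r" using k \<open>r > 0\<close> \<open>k > 0\<close> by (simp add: field_simps)
      finally show ?thesis using dist[of N] that by simp
    qed
    then show "\<exists>no. \<forall>n\<ge>no. norm (real (card (A \<inter> {..<n})) / real n - 1) < r" by blast
  qed
qed

lemma density_one_mono:
  assumes "density_one A" "A \<subseteq> B"
  shows "density_one B"
  unfolding density_one_iff
proof
  fix k
  obtain h where h: "\<And>N. N \<ge> h \<Longrightarrow> k * card ({..<N} - A) \<le> N"
    using assms(1) unfolding density_one_iff by blast
  have "card ({..<N} - B) \<le> card ({..<N} - A)" for N
    using assms(2) by (intro card_mono) auto
  then show "\<exists>h. \<forall>N\<ge>h. k * card ({..<N} - B) \<le> N"
    using h by (meson le_trans mult_le_mono2)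
qed

lemma density_one_Int:
  assumes "density_one A" "density_one B"
  shows "density_one (A \<inter> B)"
  unfolding density_one_iff
proof
  fix k
  obtain h where h: "\<And>N. N \<ge> h \<Longrightarrow> (2 * k) * card ({..<N} - A) \<le> N"
    using assms(1) unfolding density_one_iff by blast
  obtain h' where h': "\<And>N. N \<ge> h' \<Longrightarrow> (2 * k) * card ({..<N} - B) \<le> N"
    using assms(2) unfolding density_one_iff by blast
  have "k * card ({..<N} - A \<inter> B) \<le> N" if "N \<ge> max h h'" for N
  proof -
    have "card ({..<N} - A \<inter> B) \<le> card ({..<N} - A) + card ({..<N} - B)"
      unfolding Diff_Int by (rule card_Un_le)
    then have "2 * k * card ({..<N} - A \<inter> B) \<le> 2 * k * (card ({..<N} - A) + card ({..<N} - B))"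
      by (rule mult_le_mono2)
    also have "\<dots> \<le> N + N" using h[of N] h'[of N] that by (simp add: algebra_simps)
    finally show ?thesis by simp
  qed
  then show "\<exists>h. \<forall>N\<ge>h. k * card ({..<N} - A \<inter> B) \<le> N" by blast
qed

lemma density_one_UNIV: "density_one UNIV"
  by (simp add: density_one_iff)

lemma density_one_Diff_finite:
  assumes "density_one A" "finite F"
  shows "density_one (A - F)"
proof -
  have "density_one (- F)"
    unfolding density_one_iff
  proof
    fix k
    have "card ({..<N} - (- F)) \<le> card F" for N
      using assms(2) by (intro card_mono) auto
    then show "\<exists>h. \<forall>N\<ge>h. k * card ({..<N} - (- F)) \<le> N"
      by (intro exI[of _ "k * card F"]) (meson le_trans mult_le_mono2)
  qed
  from density_one_Int[OF assms(1) this] show ?thesis by (simp add: Diff_eq)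
qed

text \<open>Below \<open>2 ^ Suc m * q\<close> the column has \<open>q\<close> members. This
  positive density prevents it from lying in the complement of \<open>A\<close>.\<close>

lemma density_one_meets_column:
  assumes "density_one A"
  shows "\<exists>k. 2 ^ m * (2 * k + 1) \<in> A"
proof (rule ccontr)
  assume none: "\<nexists>k. 2 ^ m * (2 * k + 1) \<in> A"
  define K :: nat where "K = 2 ^ Suc m"
  obtain h where h: "\<And>N. N \<ge> h \<Longrightarrow> (K + 1) * card ({..<N} - A) \<le> N"
    using assms unfolding density_one_iff by blast
  define q where "q = Suc h"
  have "1 * q \<le> K * q" by (intro mult_le_mono1) (simp add: K_def)
  then have "K * q \<ge> h" by (simp add: q_def)
  have "(\<lambda>k. 2 ^ m * (2 * k + 1)) ` {..<q} \<subseteq> {..<K * q} - A"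
  proof
    fix x assume "x \<in> (\<lambda>k. 2 ^ m * (2 * k + 1)) ` {..<q}"
    then obtain k where k: "k < q" "x = 2 ^ m * (2 * k + 1)" by blast
    have "2 ^ m * (2 * k + 1) < 2 ^ m * (2 * q)" using k(1) by (intro mult_strict_left_mono) auto
    then have "x < 2 ^ m * (2 * q)" using k(2) by simp
    then show "x \<in> {..<K * q} - A" using none k(2) by (auto simp: K_def)
  qed
  then have "card ((\<lambda>k. 2 ^ m * (2 * k + 1)) ` {..<q}) \<le> card ({..<K * q} - A)"
    by (rule card_mono[rotated]) simp
  moreover have "inj_on (\<lambda>k::nat. 2 ^ m * (2 * k + 1)) {..<q}"
    by (simp add: inj_on_def)
  ultimately have "q \<le> card ({..<K * q} - A)" by (simp add: card_image)
  then have "(K + 1) * q \<le> K * q"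
    using h[OF \<open>K * q \<ge> h\<close>] by (meson le_trans mult_le_mono2)
  then show False by (simp add: q_def)
qed

lemma power2_odd_unique:
  assumes "2 ^ m * (2 * k + 1) = (2 ^ m' * (2 * k' + 1) :: nat)"
  shows "m = m'"
  using assms
proof (induction m arbitrary: m')
  case 0
  then have eq: "2 ^ m' * (2 * k' + 1) = 2 * k + 1" by simp
  have "odd (2 ^ m' * (2 * k' + 1))" unfolding eq by simp
  then show ?case by simp
next
  case (Suc m)
  show ?case
  proof (cases m')
    case 0
    then have eq: "2 ^ Suc m * (2 * k + 1) = 2 * k' + 1" using Suc.prems by simp
    have "odd (2 ^ Suc m * (2 * k + 1))" unfolding eq by simp
    then show ?thesis by simp
  next
    case (Suc j)
    then show ?thesis using Suc.prems Suc.IH[of j] by simp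
  qed
qed

lemma R_iff: "2 ^ m * (2 * k + 1) \<in> \<R> A \<longleftrightarrow> m \<in> A"
proof
  assume "2 ^ m * (2 * k + 1) \<in> \<R> A"
  then obtain m' k' where "2 ^ m * (2 * k + 1) = 2 ^ m' * (2 * k' + 1)" "m' \<in> A"
    unfolding \<R>_def by (auto elim!: oddE)
  then show "m \<in> A" using power2_odd_unique by blast
next
  assume "m \<in> A"
  then show "2 ^ m * (2 * k + 1) \<in> \<R> A"
    unfolding \<R>_def by (intro CollectI exI[of _ m] exI[of _ "2 * k + 1"]) simp
qed

text \<open>With both quantifiers bounded, \<open>\<R> A\<close> is computable from
  \<open>A\<close>.\<close>

lemma R_bounded: "n \<in> \<R> A \<longleftrightarrow> (\<exists>m<n. \<exists>k<n. n = 2 ^ m * (2 * k + 1) \<and> m \<in> A)"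
proof
  assume "n \<in> \<R> A"
  then obtain m k where mk: "m \<in> A" "n = 2 ^ m * (2 * k + 1)"
    unfolding \<R>_def by (auto elim!: oddE)
  have "m < 2 ^ m" by (rule less_exp)
  also have "2 ^ m \<le> n" using mult_le_mono2[of 1 "2 * k + 1" "2 ^ m"] mk(2) by simp
  finally have "m < n" .
  have "k < 2 * k + 1" by simp
  also have "\<dots> \<le> n" using mult_le_mono1[of 1 "2 ^ m" "2 * k + 1"] mk(2) by simp
  finally show "\<exists>m<n. \<exists>k<n. n = 2 ^ m * (2 * k + 1) \<and> m \<in> A" using mk \<open>m < n\<close> by blast
next
  assume "\<exists>m<n. \<exists>k<n. n = 2 ^ m * (2 * k + 1) \<and> m \<in> A"
  then show "n \<in> \<R> A" using R_iff by auto
qed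

section \<open>Hyperarithmetic reals are generically reducible to density-one sets\<close>

definition sparse_coding :: "(nat \<Rightarrow> nat) \<Rightarrow> nat set" where
  "sparse_coding w = {x. \<forall>m k. x = 2 ^ m * (2 * k + 1) \<longrightarrow> w m < x}"

text \<open>The first \<open>k\<close> columns lose at most \<open>C\<close> numbers in all, and
  every other missing number is a multiple of \<open>2 ^ k\<close>. As
  \<open>2 * k \<le> 2 ^ k\<close>, the total times \<open>k\<close> is eventually at most
  \<open>N\<close>.\<close>

lemma density_one_sparse_coding: "density_one (sparse_coding w)"
  unfolding density_one_iff
proof
  fix k
  define C where "C = (\<Sum>m<k. Suc (w m))"
  have bound: "card ({..<N} - sparse_coding w) \<le> C + (N div 2 ^ k + 1)" for N
  proof -
    have "{..<N} - sparse_coding w \<subseteq> (\<Union>m<k. {..w m}) \<union> (\<lambda>q. 2 ^ k * q) ` {..N div 2 ^ k}"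
    proof
      fix x assume "x \<in> {..<N} - sparse_coding w"
      then obtain m l where x: "x < N" "x = 2 ^ m * (2 * l + 1)" "x \<le> w m"
        unfolding sparse_coding_def by auto
      show "x \<in> (\<Union>m<k. {..w m}) \<union> (\<lambda>q. 2 ^ k * q) ` {..N div 2 ^ k}"
      proof (cases "m < k")
        case True
        then show ?thesis using x(3) by blast
      next
        case False
        then have "2 ^ k dvd x" unfolding x(2) by (intro dvd_mult2 le_imp_power_dvd) simp
        then obtain q where q: "x = 2 ^ k * q" by blast
        moreover have "q \<le> N div 2 ^ k"
          using x(1) q by (simp add: less_eq_div_iff_mult_less_eq mult.commute)
        ultimately show ?thesis by blast
      qed
    qed
    then have "card ({..<N} - sparse_coding w) \<le> card ((\<Union>m<k. {..w m}) \<union> (\<lambda>q. 2 ^ k * q) ` {..N div 2 ^ k})"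
      by (rule card_mono[rotated]) simp
    also have "\<dots> \<le> card (\<Union>m<k. {..w m}) + card ((\<lambda>q. 2 ^ k * q) ` {..N div 2 ^ k})"
      by (rule card_Un_le)
    also have "\<dots> \<le> C + (N div 2 ^ k + 1)"
    proof (rule add_mono)
      show "card (\<Union>m<k. {..w m}) \<le> C"
        unfolding C_def using card_UN_le[of "{..<k}" "\<lambda>m. {..w m}"] by simp
      show "card ((\<lambda>q. 2 ^ k * q) ` {..N div 2 ^ k}) \<le> N div 2 ^ k + 1"
        using card_image_le[of "{..N div 2 ^ k}" "\<lambda>q. 2 ^ k * q"] by simp
    qed
    finally show ?thesis .
  qed
  have "k * card ({..<N} - sparse_coding w) \<le> N" if N: "N \<ge> 2 * k * (C + 1)" for N
  proof -
    have "2 * k \<le> 2 ^ k"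
    proof (cases k)
      case (Suc j)
      have "Suc j \<le> 2 ^ j" using less_exp[of j] by (simp only: Suc_le_eq)
      then show ?thesis using Suc by simp
    qed simp
    then have "2 * k * (N div 2 ^ k) \<le> 2 ^ k * (N div 2 ^ k)" by (rule mult_le_mono1)
    also have "\<dots> \<le> N" by (rule times_div_less_eq_dividend)
    finally have "2 * k * (N div 2 ^ k) \<le> N" .
    moreover have "2 * k * card ({..<N} - sparse_coding w) \<le> 2 * k * (C + (N div 2 ^ k + 1))"
      using bound by (rule mult_le_mono2)
    ultimately have "2 * k * card ({..<N} - sparse_coding w) \<le> N + N"
      using N by (simp add: algebra_simps)
    then show ?thesis by simp
  qed
  then show "\<exists>h. \<forall>N\<ge>h. k * card ({..<N} - sparse_coding w) \<le> N" by blast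
qed

text \<open>The intersection of \<open>B\<close> with the domain of \<open>P\<close> has density one
  and so meets column \<open>m\<close>; there a partial oracle for \<open>B\<close> can only answer
  \<open>1\<close>.\<close>

lemma generic_oracle_finds_column:
  assumes "generic_oracle P B" "density_one B"
  shows "\<exists>k l. triple (2 ^ m * (2 * k + 1)) 1 l \<in> P"
proof -
  have "density_one (oracle_dom P \<inter> B)"
    using assms by (simp add: generic_oracle_def density_one_Int)
  then obtain k where k: "2 ^ m * (2 * k + 1) \<in> oracle_dom P" "2 ^ m * (2 * k + 1) \<in> B"
    using density_one_meets_column by blast
  then obtain x l where x: "triple (2 ^ m * (2 * k + 1)) x l \<in> P"
    unfolding oracle_dom_def by blast
  have "x \<in> {0, 1}" "x = 0 \<longrightarrow> 2 ^ m * (2 * k + 1) \<notin> B"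
    using assms(1) x unfolding generic_oracle_def partial_oracle_def by blast+
  then have "x = 1" using k(2) by auto
  with x show ?thesis by blast
qed

text \<open>The first confirmed member of column \<open>m\<close> found in \<open>P\<close> lies in
  \<open>sparse_coding w\<close> and hence exceeds \<open>w m\<close>. One search program serves all
  \<open>P\<close>.\<close>

lemma generic_oracles_dominate:
  obtains g where "computable_on {P. generic_oracle P (sparse_coding w)} g"
    "\<And>P m. generic_oracle P (sparse_coding w) \<Longrightarrow> w m \<le> g P m"
proof
  define Q where "Q P m z \<longleftrightarrow> triple (2 ^ m * (2 * p1 z + 1)) 1 (p2 z) \<in> P" for P m z
  define g where "g P m = 2 ^ m * (2 * p1 (LEAST z. Q P m z) + 1)" for P m
  have ex: "\<exists>z. Q P m z" if P: "generic_oracle P (sparse_coding w)" for P m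
  proof -
    obtain k l where "triple (2 ^ m * (2 * k + 1)) 1 l \<in> P"
      using generic_oracle_finds_column[OF P density_one_sparse_coding] by blast
    then have "Q P m (prod_encode (k, l))" by (simp add: Q_def)
    then show ?thesis ..
  qed
  show "computable_on {P. generic_oracle P (sparse_coding w)} g"
    unfolding g_def
  proof (intro computable_intros computable_on_Least)
    show "decidable_on {P. generic_oracle P (sparse_coding w)} (\<lambda>X m. Q X (p1 m) (p2 m))"
      unfolding Q_def triple_def by (intro computable_on_oracle computable_intros)
  qed (use ex in blast)
  show "w m \<le> g P m" if P: "generic_oracle P (sparse_coding w)" for P m
  proof -
    have "Q P m (LEAST z. Q P m z)" using ex[OF P] by (rule LeastI_ex)
    then have "g P m \<in> sparse_coding w"
      using P unfolding Q_def g_def generic_oracle_def partial_oracle_def by blast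
    then show ?thesis unfolding sparse_coding_def g_def using less_imp_le by blast
  qed
qed

text \<open>Halting on one's own number is a diagonal entry of the table, so the table itself can
  answer queries to jumps.\<close>

lemma mem_turing_jump_iff: "x \<in> turing_jump (Y b) \<longleftrightarrow> eval_table Y (eval_index b x x) \<noteq> 0"
  by (cases "x \<in> range code_num") (auto simp: turing_jump_def code_num_inject dom_def)

lemma mem_Collect_prod_encode: "n \<in> {prod_encode (b, x) |b x. P b x} \<longleftrightarrow> P (p1 n) (p2 n)"
proof -
  have "n = prod_encode (b, x) \<longleftrightarrow> b = p1 n \<and> x = p2 n" for b x by auto
  then show ?thesis by simp
qed

lemma hyperarithmetic_imp_generically_reduces:
  assumes "hyperarithmetic A"
  shows "\<exists>B. density_one B \<and> B \<ge>\<^sub>g \<R> A"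
proof -
  from assms obtain R where R: "Well_order R" and rec: "recursive_set (prod_encode ` R)"
    and A: "A \<le>\<^sub>T iterated_jump R"
    unfolding hyperarithmetic_def recursive_well_order_def by blast
  define Y where "Y = iterated_jump_at R"
  \<comment> \<open>A query to stage \<open>b\<close> is a pair of an element and a program. It
    holds iff the element is strictly \<open>R\<close>-below \<open>b\<close> and the program halts
    on its own number relative to that earlier stage, an entry in the row of that element.\<close>
  define t where "t b n \<longleftrightarrow> prod_encode (p1 n, b) \<in> prod_encode ` R \<and> \<not> p1 n = b" for b n
  define r where "r b n = eval_index (p1 n) (p2 n) (p2 n)" for b n :: nat
  have R_iff: "prod_encode (a, b) \<in> prod_encode ` R \<longleftrightarrow> (a, b) \<in> R" for a b
    by (simp add: inj_image_mem_iff inj_prod_encode)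
  have query: "n \<in> Y b \<longleftrightarrow> t b n \<and> eval_table Y (r b n) \<noteq> 0" for b n
  proof -
    have "n \<in> Y b \<longleftrightarrow> (p1 n, b) \<in> R - Id \<and> p2 n \<in> turing_jump (Y (p1 n))"
      unfolding Y_def
      by (subst iterated_jump_at_unfold[OF R]) (simp only: mem_Collect_prod_encode)
    then show ?thesis by (auto simp: t_def r_def R_iff mem_turing_jump_iff)
  qed
  have wf: "wf (R - Id)" using R by (simp add: well_order_on_def)
  define w where "w = eval_table Y"
  have path: "path (table_condition t r) w"
    unfolding w_def by (rule path_eval_table) (rule query)
  have unique: "f = w" if "path (table_condition t r) f" for f
    unfolding w_def by (rule path_table_unique[OF wf that query]) (auto simp: t_def r_def R_iff)
  define S where "S = {P. generic_oracle P (sparse_coding w)}"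
  have decR: "decidable_on S (\<lambda>X m. m \<in> prod_encode ` R)"
    using rec by (rule decidable_on_recursive_set)
  have cond: "decidable_on S (\<lambda>X m. table_condition t r (look (p1 m)) (p2 m))"
    by (rule decidable_on_table_condition[where G = "\<lambda>_. look"], unfold t_def r_def)
      (intro computable_intros computable_on_look computable_on_compose[OF decR])+
  obtain g where "computable_on S g" "\<And>P m. P \<in> S \<Longrightarrow> w m \<le> g P m"
    by (rule generic_oracles_dominate[of w]) (simp add: S_def)
  then have w: "computable_on S (\<lambda>X i. w i)"
    by (intro computable_on_unique_path[OF closed_class_table_condition cond path unique])
  have "n \<in> iterated_jump R \<longleftrightarrow>
      prod_encode (p1 n, p1 n) \<in> prod_encode ` R \<and> \<not> w (eval_index (p1 n) (p2 n) (p2 n)) = 0" for n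
  proof -
    \<comment> \<open>By reflexivity, membership in the field is read off the recursive set coding
      \<open>R\<close>.\<close>
    have "b \<in> Field R \<longleftrightarrow> (b, b) \<in> R" for b
      using R by (auto simp: order_on_defs refl_on_def FieldI1)
    moreover have "n \<in> iterated_jump R \<longleftrightarrow> p1 n \<in> Field R \<and> p2 n \<in> turing_jump (Y (p1 n))"
      unfolding iterated_jump_def Y_def by (simp only: mem_Collect_prod_encode)
    ultimately show ?thesis by (simp add: R_iff mem_turing_jump_iff w_def)
  qed
  moreover have "decidable_on S (\<lambda>X n. prod_encode (p1 n, p1 n) \<in> prod_encode ` R \<and>
      \<not> w (eval_index (p1 n) (p2 n) (p2 n)) = 0)"
    by (intro computable_intros computable_on_compose[OF decR] computable_on_compose[OF w])
  ultimately have "decidable_on S (\<lambda>X n. n \<in> iterated_jump R)" by (simp only:)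
  then have decA: "decidable_on S (\<lambda>X n. n \<in> A)" by (rule decidable_on_turing_reducible[OF A])
  have "decidable_on S (\<lambda>X n. n \<in> \<R> A)"
    unfolding R_bounded by (intro computable_intros computable_on_compose[OF decA])
  then obtain c where c: "\<And>P n. P \<in> S \<Longrightarrow> run P c n = Some (of_bool (n \<in> \<R> A))"
    unfolding computable_on_def by blast
  have "generic_computation (run P c) (\<R> A)" if "generic_oracle P (sparse_coding w)" for P
  proof -
    have "run P c n = Some (of_bool (n \<in> \<R> A))" for n using c that by (simp add: S_def)
    then have "run P c = (\<lambda>n. Some (of_bool (n \<in> \<R> A)))" by (rule ext)
    then show ?thesis by (auto simp: generic_computation_def dom_def density_one_UNIV ran_def)
  qed
  then show ?thesis
    unfolding generically_reduces_def
    by (intro exI[of _ "sparse_coding w"] conjI density_one_sparse_coding exI[of _ c]) simp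
qed

section \<open>Games on well-founded trees\<close>

text \<open>Extensions come before their prefixes, so a position in a game follows all positions
  reachable from it, as the iteration of jumps requires.\<close>

fun kleene_brouwer :: "nat list \<Rightarrow> nat list \<Rightarrow> bool" where
  "kleene_brouwer u [] = True"
| "kleene_brouwer [] (y # v) = False"
| "kleene_brouwer (x # u) (y # v) = (x < y \<or> x = y \<and> kleene_brouwer u v)"

lemma kleene_brouwer_refl: "kleene_brouwer u u"
  by (induction u) auto

lemma kleene_brouwer_append: "kleene_brouwer (p @ u) (p @ v) \<longleftrightarrow> kleene_brouwer u v"
  by (induction p) auto

lemma kleene_brouwer_total: "kleene_brouwer u v \<or> kleene_brouwer v u"
  by (induction u v rule: kleene_brouwer.induct) auto

lemma kleene_brouwer_antisym:
  assumes "kleene_brouwer u v" "kleene_brouwer v u"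
  shows "u = v"
  using assms by (induction u v rule: kleene_brouwer.induct) (auto elim: kleene_brouwer.elims)

lemma kleene_brouwer_trans:
  assumes "kleene_brouwer u v" "kleene_brouwer v w"
  shows "kleene_brouwer u w"
  using assms
proof (induction u v arbitrary: w rule: kleene_brouwer.induct)
  case (1 u)
  then show ?case by (cases w) auto
next
  case (3 x u y v)
  then show ?case by (cases w) auto
qed simp

lemma kleene_brouwer_look:
  "kleene_brouwer u v \<longleftrightarrow> u = v \<or>
     (\<exists>i<length u. (\<forall>j<i. look_list u j = look_list v j) \<and>
        (look_list v i = 0 \<or> look_list u i < look_list v i))"
proof (induction u v rule: kleene_brouwer.induct)
  case (1 u)
  then show ?case by (cases u) (auto simp: look_list_def)
next
  case (2 y v)
  then show ?case by simp
next
  case (3 x u y v)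
  have [simp]: "look_list (z # l) 0 = Suc z" "look_list (z # l) (Suc i) = look_list l i" for z l i
    by (simp_all add: look_list_def)
  show ?case
    by (simp add: Ex_less_Suc2 All_less_Suc2 3) auto
qed

locale well_founded_tree =
  fixes W :: "nat list set"
  assumes prefix: "u @ v \<in> W \<Longrightarrow> u \<in> W"
    and no_branch: "\<not> (\<forall>L. map f [0..<L] \<in> W)"
begin

text \<open>Bar induction: having least elements for all nonempty sets of extensions is inherited
  from the children of a node, and failure at the root would propagate along an infinite
  branch.\<close>

lemma kleene_brouwer_minimum:
  assumes "Z \<subseteq> W" "Z \<noteq> {}"
  shows "\<exists>z\<in>Z. \<forall>s\<in>Z. kleene_brouwer z s"
proof -
  define good where "good p \<longleftrightarrow>
    (\<forall>Z. Z \<subseteq> {s \<in> W. \<exists>v. s = p @ v} \<longrightarrow> Z \<noteq> {} \<longrightarrow> (\<exists>z\<in>Z. \<forall>s\<in>Z. kleene_brouwer z s))" for p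
  have step: "good p" if sub: "\<And>k. p @ [k] \<in> W \<Longrightarrow> good (p @ [k])" for p
    unfolding good_def
  proof (intro allI impI)
    fix Z assume Z: "Z \<subseteq> {s \<in> W. \<exists>v. s = p @ v}" "Z \<noteq> {}"
    show "\<exists>z\<in>Z. \<forall>s\<in>Z. kleene_brouwer z s"
    proof (cases "\<exists>k v. p @ k # v \<in> Z")
      case False
      have "Z = {p}"
      proof -
        have "s = p" if "s \<in> Z" for s
        proof -
          obtain v where "s = p @ v" using Z(1) \<open>s \<in> Z\<close> by blast
          then show ?thesis using False \<open>s \<in> Z\<close> by (cases v) auto
        qed
        then show ?thesis using Z(2) by blast
      qed
      then show ?thesis by (simp add: kleene_brouwer_refl)
    next
      case True
      \<comment> \<open>The minimum is sought among extensions with the smallest next entry;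
        \<open>p\<close> itself comes last and matters only if it is alone.\<close>
      define k where "k = (LEAST k. \<exists>v. p @ k # v \<in> Z)"
      obtain v where v: "p @ k # v \<in> Z" unfolding k_def using LeastI_ex[OF True] by blast
      have least: "k \<le> k'" if "p @ k' # v' \<in> Z" for k' v'
        unfolding k_def by (rule Least_le) (use that in blast)
      have "p @ k # v \<in> W" using v Z(1) by blast
      then have "p @ [k] \<in> W" using prefix[of "p @ [k]" v] by simp
      then have "good (p @ [k])" by (rule sub)
      moreover have "{s \<in> Z. \<exists>v. s = (p @ [k]) @ v} \<subseteq> {s \<in> W. \<exists>v. s = (p @ [k]) @ v}"
        using Z(1) by blast
      moreover have "{s \<in> Z. \<exists>v. s = (p @ [k]) @ v} \<noteq> {}" using v by auto
      ultimately obtain z where z: "z \<in> {s \<in> Z. \<exists>v. s = (p @ [k]) @ v}"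
        and min: "\<And>s. s \<in> {s \<in> Z. \<exists>v. s = (p @ [k]) @ v} \<Longrightarrow> kleene_brouwer z s"
        unfolding good_def by meson
      obtain z' where z': "z = p @ k # z'" using z by auto
      have "kleene_brouwer z s" if "s \<in> Z" for s
      proof -
        obtain w where w: "s = p @ w" using Z(1) \<open>s \<in> Z\<close> by blast
        show ?thesis
        proof (cases w)
          case Nil
          then show ?thesis using kleene_brouwer_append[of p "k # z'" "[]"] by (simp add: w z')
        next
          case (Cons k' w')
          then have "k \<le> k'" using least \<open>s \<in> Z\<close> w by blast
          show ?thesis
          proof (cases "k = k'")
            case True
            then show ?thesis using min[of s] \<open>s \<in> Z\<close> w Cons by simp
          next
            case False
            then show ?thesis using \<open>k \<le> k'\<close> by (simp add: z' w Cons kleene_brouwer_append)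
          qed
        qed
      qed
      then show ?thesis using z by blast
    qed
  qed
  have "good []"
  proof (rule ccontr)
    assume "\<not> good []"
    moreover have "[] \<in> W" using assms prefix[of "[]"] by auto
    moreover have "\<exists>k. p @ [k] \<in> W \<and> \<not> good (p @ [k])" if "p \<in> W \<and> \<not> good p" for p
      using step that by blast
    ultimately obtain f where "\<And>L. map f [0..<L] \<in> W \<and> \<not> good (map f [0..<L])"
      using list_limit[of "\<lambda>p. p \<in> W \<and> \<not> good p"] by blast
    then show False using no_branch[of f] by blast
  qed
  moreover have "Z \<subseteq> {s \<in> W. \<exists>v. s = [] @ v}" using assms(1) by auto
  ultimately show ?thesis using assms(2) unfolding good_def by blast
qed

definition node_order :: "nat rel" where
  "node_order = {(a, b). list_decode a \<in> W \<and> list_decode b \<in> W \<and>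
     kleene_brouwer (list_decode a) (list_decode b)}"

lemma node_order_encode:
  "(list_encode u, list_encode v) \<in> node_order \<longleftrightarrow> u \<in> W \<and> v \<in> W \<and> kleene_brouwer u v"
  by (simp add: node_order_def)

lemma Field_node_order: "Field node_order = {a. list_decode a \<in> W}"
  by (auto simp: Field_def node_order_def intro: kleene_brouwer_refl)

lemma Well_order_node_order: "Well_order node_order"
proof -
  have "refl_on (Field node_order) node_order"
    unfolding Field_node_order by (auto simp: refl_on_def node_order_def kleene_brouwer_refl)
  moreover have "trans node_order"
    by (auto simp: trans_def node_order_def intro: kleene_brouwer_trans)
  moreover have "antisym node_order"
    unfolding antisym_def node_order_def
    by (auto dest: kleene_brouwer_antisym) (metis kleene_brouwer_antisym list_decode_inverse)
  moreover have "total_on (Field node_order) node_order"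
    unfolding Field_node_order using kleene_brouwer_total by (auto simp: total_on_def node_order_def)
  moreover have "wf (node_order - Id)"
  proof (rule wfI_min)
    fix x :: nat and Q assume "x \<in> Q"
    show "\<exists>z\<in>Q. \<forall>y. (y, z) \<in> node_order - Id \<longrightarrow> y \<notin> Q"
    proof (cases "\<exists>a\<in>Q. list_decode a \<in> W")
      case False
      then show ?thesis using \<open>x \<in> Q\<close> by (auto simp: node_order_def)
    next
      case True
      then have "list_decode ` Q \<inter> W \<noteq> {}" by blast
      then obtain z where z: "z \<in> Q" "list_decode z \<in> W"
          "\<And>s. s \<in> list_decode ` Q \<inter> W \<Longrightarrow> kleene_brouwer (list_decode z) s"
        using kleene_brouwer_minimum[of "list_decode ` Q \<inter> W"] by auto
      have "y \<notin> Q" if "(y, z) \<in> node_order - Id" for y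
      proof
        assume "y \<in> Q"
        have "list_decode y \<in> W" "kleene_brouwer (list_decode y) (list_decode z)"
          using that by (auto simp: node_order_def)
        then have "list_decode y = list_decode z"
          using z(3)[of "list_decode y"] \<open>y \<in> Q\<close> by (blast intro: kleene_brouwer_antisym)
        then have "y = z" by (metis list_decode_inverse)
        with that show False by simp
      qed
      then show ?thesis using z(1) by blast
    qed
  qed
  ultimately show ?thesis
    by (auto simp: order_on_defs Field_def)
qed

lemma recursive_node_order:
  assumes "recursive_set (list_encode ` W)"
  shows "recursive_set (prod_encode ` node_order)"
proof -
  have W: "decidable_on S (\<lambda>X m. m \<in> list_encode ` W)" for S
    using assms by (rule decidable_on_recursive_set)
  define K where "K a b \<longleftrightarrow> a = b \<or> (\<exists>i<a. \<not> look a i = 0 \<and>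
      (\<forall>j<i. look a j = look b j) \<and> (look b i = 0 \<or> look a i < look b i))" for a b
  have "K (list_encode u) (list_encode v) \<longleftrightarrow> kleene_brouwer u v" for u v
  proof -
    \<comment> \<open>Length is bounded by the code, so bounding \<open>i\<close> by the code loses
      nothing; the nonzero lookup restores \<open>i < length u\<close>.\<close>
    have *: "(i < list_encode u \<and> \<not> look_list u i = 0) \<longleftrightarrow> i < length u" for i
      using length_le_list_encode[of u] by (auto simp: look_list_def)
    have "(\<exists>i<list_encode u. \<not> look_list u i = 0 \<and> P i) \<longleftrightarrow> (\<exists>i<length u. P i)" for P
      unfolding conj_assoc[symmetric] * ..
    then show ?thesis
      unfolding K_def kleene_brouwer_look look_list_encode list_encode_eq by (simp only:)
  qed
  then have eq: "m \<in> prod_encode ` node_order \<longleftrightarrow>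
      p1 m \<in> list_encode ` W \<and> p2 m \<in> list_encode ` W \<and> K (p1 m) (p2 m)" for m
  proof -
    define u v where "u = list_decode (p1 m)" and "v = list_decode (p2 m)"
    then have m: "m = prod_encode (list_encode u, list_encode v)" by simp
    have "list_encode w \<in> list_encode ` W \<longleftrightarrow> w \<in> W" for w
      by (simp add: inj_image_mem_iff inj_list_encode)
    then show ?thesis
      using \<open>\<And>u v. K (list_encode u) (list_encode v) \<longleftrightarrow> kleene_brouwer u v\<close>
      by (simp add: m inj_image_mem_iff inj_prod_encode node_order_encode)
  qed
  have "decidable_on {{}} (\<lambda>X m. p1 m \<in> list_encode ` W \<and> p2 m \<in> list_encode ` W \<and> K (p1 m) (p2 m))"
    unfolding K_def by (intro computable_intros computable_on_look computable_on_compose[OF W])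
  then show ?thesis
    unfolding recursive_set_def turing_reducible_iff by (simp only: eq)
qed

end

section \<open>Winning positions by iterated jumps\<close>

definition child_code :: "nat \<Rightarrow> nat \<Rightarrow> bool" where
  "child_code a b \<longleftrightarrow> (\<exists>m<Suc b. (\<forall>j<m. \<not> look a j = 0 \<and> look b j = look a j) \<and>
     look a m = 0 \<and> \<not> look b m = 0 \<and> look b (Suc m) = 0)"

lemma child_code_encode: "child_code (list_encode u) (list_encode v) \<longleftrightarrow> (\<exists>k. v = u @ [k])"
proof
  assume "child_code (list_encode u) (list_encode v)"
  then obtain m where m: "\<And>j. j < m \<Longrightarrow> look_list u j \<noteq> 0 \<and> look_list v j = look_list u j"
    "look_list u m = 0" "look_list v m \<noteq> 0" "look_list v (Suc m) = 0"
    unfolding child_code_def by auto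
  have u: "length u = m"
    using m(1)[of "length u"] m(2) by (cases "length u < m") (auto simp: look_list_def split: if_splits)
  have v: "length v = Suc m"
    using m(3,4) by (auto simp: look_list_def split: if_splits)
  have "v = u @ [v ! m]"
  proof (rule nth_equalityI)
    fix i assume "i < length v"
    then show "v ! i = (u @ [v ! m]) ! i"
      using m(1)[of i] u v by (cases "i < m") (auto simp: nth_append look_list_def less_Suc_eq)
  qed (simp add: u v)
  then show "\<exists>k. v = u @ [k]" by blast
next
  assume "\<exists>k. v = u @ [k]"
  then obtain k where v: "v = u @ [k]" by blast
  have "length u < Suc (list_encode v)" using length_le_list_encode[of v] by (simp add: v)
  then show "child_code (list_encode u) (list_encode v)"
    unfolding child_code_def look_list_encode
    by (intro exI[of _ "length u"]) (auto simp: v look_list_def nth_append)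
qed

text \<open>
  A node \<open>a\<close> is a winning position iff the program \<open>position_code c a\<close> halts on its own number,
  for a suitable \<open>c\<close>.  As this number is its input, the program can find out the number of
  \<open>c\<close> and hence of its siblings, which makes the recursion theorem superfluous.
\<close>

definition position_code :: "code \<Rightarrow> nat \<Rightarrow> code" where
  "position_code c a = Comp c (Pair (numeral_code a) (Pair Fst Snd))"

lemma run_position_code: "run X (position_code c a) x = run X c (prod_encode (a, x))"
  by (simp add: position_code_def)

text \<open>Here \<open>x\<close> is to be the number of a program \<open>Comp c d\<close>. The tags
  \<open>6\<close> and \<open>5\<close> of \<open>Comp\<close> and \<open>Pair\<close> rebuild that
  program with the numeral for \<open>b\<close> in place of the old one.\<close>

definition sibling_num :: "nat \<Rightarrow> nat \<Rightarrow> nat" where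
  "sibling_num x b =
     prod_encode (6, prod_encode (p1 (p2 x), prod_encode (5, prod_encode
       (rec_nat (code_num Zero) (\<lambda>_ v. prod_encode (6, prod_encode (code_num Succ, v))) b,
        code_num (Pair Fst Snd)))))"

lemma sibling_num: "sibling_num (code_num (position_code c a)) b = code_num (position_code c b)"
proof -
  have "rec_nat (code_num Zero) (\<lambda>_ v. prod_encode (6, prod_encode (code_num Succ, v))) b =
      code_num (numeral_code b)"
    by (induction b) auto
  then show ?thesis by (simp add: sibling_num_def position_code_def)
qed

context well_founded_tree
begin

text \<open>A Kleene-Brouwer least counterexample has no failing child, since children precede their
  parent.\<close>

lemma tree_induct [consumes 1, case_names node]:
  assumes "p \<in> W" and step: "\<And>p. p \<in> W \<Longrightarrow> (\<And>k. p @ [k] \<in> W \<Longrightarrow> Q (p @ [k])) \<Longrightarrow> Q p"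
  shows "Q p"
proof (rule ccontr)
  assume "\<not> Q p"
  then obtain z where z: "z \<in> W" "\<not> Q z" and min: "\<And>s. s \<in> W \<Longrightarrow> \<not> Q s \<Longrightarrow> kleene_brouwer z s"
    using kleene_brouwer_minimum[of "{p \<in> W. \<not> Q p}"] assms(1) by auto
  have "Q (z @ [k])" if "z @ [k] \<in> W" for k
  proof (rule ccontr)
    assume "\<not> Q (z @ [k])"
    with min that have "kleene_brouwer (z @ []) (z @ [k])" by simp
    then show False by (simp only: kleene_brouwer_append kleene_brouwer.simps)
  qed
  with step z show False by blast
qed

text \<open>\<open>V p\<close> means that the player to move at \<open>p\<close> wins. The answers
  for the children are in the stage of \<open>p\<close>, because children come earlier; given these,
  \<open>V p\<close> is one existential question and costs one jump. \<open>start\<close> puts the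
  answers for \<open>[n]\<close> into the final join.\<close>

lemma hyperarithmetic_winning_positions:
  assumes rec: "recursive_set (list_encode ` W)" and start: "\<And>n. [n] \<in> W"
  obtains V where "\<And>p. p \<in> W \<Longrightarrow> V p \<longleftrightarrow> (\<exists>k. p @ [k] \<in> W \<and> \<not> V (p @ [k]))"
    "hyperarithmetic {n. V [n]}"
proof -
  define H where "H = iterated_jump_at node_order"
  have W: "decidable_on S (\<lambda>X m. m \<in> list_encode ` W)" for S
    using rec by (rule decidable_on_recursive_set)
  \<comment> \<open>The search looks for a losing child: the last test asks whether the program
    attached to \<open>b\<close> fails to halt relative to its own, earlier stage.\<close>
  define Q where "Q X m b \<longleftrightarrow> b \<in> list_encode ` W \<and> child_code (p1 m) b \<and>
      \<not> prod_encode (b, sibling_num (p2 m) b) \<in> X" for X m b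
  have "decidable_on UNIV (\<lambda>X m. Q X (p1 m) (p2 m))"
    unfolding Q_def child_code_def sibling_num_def
    by (intro computable_intros computable_on_rec_nat computable_on_look computable_on_oracle
        computable_on_compose[OF W])
  then obtain c where c: "\<And>X m. X \<in> UNIV \<Longrightarrow>
      run X c m = (if \<exists>b. Q X m b then Some (LEAST b. Q X m b) else None)"
    using unbounded_search by blast
  define x where "x a = code_num (position_code c a)" for a
  define V where "V p \<longleftrightarrow> x (list_encode p) \<in> turing_jump (H (list_encode p))" for p
  have jump: "x a \<in> turing_jump X \<longleftrightarrow> (\<exists>b. Q X (prod_encode (a, x a)) b)" for X a
    by (auto simp: turing_jump_def x_def code_num_inject run_position_code c dom_def)
  have H: "prod_encode (b, y) \<in> H a \<longleftrightarrow> (b, a) \<in> node_order - Id \<and> y \<in> turing_jump (H b)" for a b y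
    unfolding H_def
    by (subst iterated_jump_at_unfold[OF Well_order_node_order]) (simp only: mem_Collect_prod_encode prod_encode_inverse fst_conv snd_conv)
  have V: "V p \<longleftrightarrow> (\<exists>k. p @ [k] \<in> W \<and> \<not> V (p @ [k]))" if p: "p \<in> W" for p
  proof -
    have IH: "prod_encode (list_encode (p @ [k]), x (list_encode (p @ [k]))) \<in> H (list_encode p) \<longleftrightarrow> V (p @ [k])"
      if "p @ [k] \<in> W" for k
    proof -
      have "(list_encode (p @ [k]), list_encode p) \<in> node_order - Id"
        using that p kleene_brouwer_append[of p "[k]" "[]"]
        by (auto simp: node_order_encode list_encode_eq)
      then show ?thesis using H V_def by simp
    qed
    have "V p \<longleftrightarrow>
        (\<exists>b. b \<in> list_encode ` W \<and> child_code (list_encode p) b \<and> prod_encode (b, x b) \<notin> H (list_encode p))"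
      unfolding V_def jump Q_def by (simp add: x_def sibling_num)
    also have "\<dots> \<longleftrightarrow> (\<exists>k. p @ [k] \<in> W \<and>
        prod_encode (list_encode (p @ [k]), x (list_encode (p @ [k]))) \<notin> H (list_encode p))"
      by (simp only: Bex_def[symmetric] bex_simps child_code_encode) blast
    also have "\<dots> \<longleftrightarrow> (\<exists>k. p @ [k] \<in> W \<and> \<not> V (p @ [k]))"
      by (simp only: IH cong: conj_cong)
    finally show ?thesis .
  qed
  have eq: "n \<in> {n. V [n]} \<longleftrightarrow> prod_encode (list_encode [n], x (list_encode [n])) \<in> iterated_jump node_order" for n
    using start[of n] unfolding iterated_jump_def Field_node_order H_def V_def
    by (simp only: mem_Collect_prod_encode prod_encode_inverse fst_conv snd_conv mem_Collect_eq list_encode_inverse simp_thms)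
  have "decidable_on {iterated_jump node_order}
     (\<lambda>X n. prod_encode (list_encode [n], x (list_encode [n])) \<in> X)"
  proof -
    \<comment> \<open>All program numbers are obtained computably from the one for node
      \<open>0\<close>.\<close>
    have x: "x b = sibling_num (x 0) b" for b by (simp add: x_def sibling_num)
    have "decidable_on {iterated_jump node_order}
     (\<lambda>X n. prod_encode (Suc (prod_encode (n, 0)), sibling_num (x 0) (Suc (prod_encode (n, 0)))) \<in> X)"
      unfolding sibling_num_def
      by (intro computable_intros computable_on_rec_nat computable_on_oracle)
    then show ?thesis by (subst x) simp
  qed
  then have "{n. V [n]} \<le>\<^sub>T iterated_jump node_order"
    unfolding turing_reducible_iff by (rule computable_on_cong) (simp only: eq singleton_iff)
  then have "hyperarithmetic {n. V [n]}"
    unfolding hyperarithmetic_def recursive_well_order_def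
    using Well_order_node_order recursive_node_order[OF rec] by blast
  with V show thesis by (rule that)
qed

end

text \<open>For each \<open>n\<close> exactly one of two closed classes has a path. Players
  \<open>0\<close> and \<open>1\<close> build paths in turn; no infinite play is legal, and who gets
  stuck decides \<open>n\<close>. As \<open>C\<close> takes a function argument, \<open>dec\<close>
  is phrased for computable arguments.\<close>

lemma hyperarithmetic_if_separated:
  fixes C :: "nat \<Rightarrow> nat \<Rightarrow> (nat \<Rightarrow> nat) \<Rightarrow> nat \<Rightarrow> bool"
  assumes closed: "\<And>n v. closed_class (C n v)"
    and dec: "\<And>G n v s i. computable_on {{}} (\<lambda>X m. G X (p1 m) (p2 m)) \<Longrightarrow>
      computable_on {{}} n \<Longrightarrow> computable_on {{}} v \<Longrightarrow> computable_on {{}} s \<Longrightarrow> computable_on {{}} i \<Longrightarrow>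
      decidable_on {{}} (\<lambda>X m. C (n X m) (v X m) (G X (s X m)) (i X m))"
    and nonempty: "\<And>n. \<exists>f. path (C n (of_bool (n \<notin> A))) f"
    and empty: "\<And>n f. \<not> path (C n (of_bool (n \<in> A))) f"
  shows "hyperarithmetic A"
proof -
  \<comment> \<open>Entry \<open>0\<close> of a position is the number in question; player
    \<open>v\<close> fills the places \<open>2 * j + 1 + v\<close>.\<close>
  define moves where "moves v p j = look_list p (2 * j + 1 + v)" for v p j
  \<comment> \<open>Condition \<open>i\<close> is imposed only once move \<open>i\<close> has been
    made, so only conditions with index below the length of the position need checking.\<close>
  define legal where "legal p v i \<longleftrightarrow> moves v p i = 0 \<or> C (look_list p 0 - 1) v (moves v p) i" for p v i
  define W where "W = {p. \<forall>i<length p. \<forall>v<2. legal p v i}"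
  have W_iff: "p \<in> W \<longleftrightarrow> (\<forall>i. \<forall>v<2. legal p v i)" for p
  proof -
    have "legal p v i" if "\<not> i < length p" for v i
      using that by (simp add: legal_def moves_def look_list_def)
    then show ?thesis unfolding W_def by blast
  qed
  have antimono: "C n v (moves v p) i" if "C n v G i" "\<And>j. moves v p j \<noteq> 0 \<Longrightarrow> moves v p j = G j" for n v p i G
    using that closed_class_antimono[OF closed] unfolding partial_le_def by metis
  have legal_prefix: "legal u v i" if "legal (u @ w) v i" for u w v i
  proof (cases "moves v u i = 0")
    case False
    then have "u \<noteq> []" by (auto simp: moves_def look_list_def)
    have eq: "moves v u j \<noteq> 0 \<Longrightarrow> moves v u j = moves v (u @ w) j" for j
      by (auto simp: moves_def look_list_def nth_append split: if_splits)
    have "look_list (u @ w) 0 = look_list u 0"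
      using \<open>u \<noteq> []\<close> by (simp add: look_list_def nth_append)
    with that False eq[of i] have "C (look_list u 0 - 1) v (moves v (u @ w)) i" by (simp add: legal_def)
    then have "C (look_list u 0 - 1) v (moves v u) i" by (rule antimono) (rule eq)
    then show ?thesis by (simp add: legal_def)
  qed (simp add: legal_def)
  have branch: "path (C (f 0) v) (\<lambda>j. f (2 * j + 1 + v))"
    if f: "\<And>L. map f [0..<L] \<in> W" and v: "v < 2" for f v
    unfolding path_def
  proof (intro allI closed_class_limit[OF closed])
    fix i L
    \<comment> \<open>Long enough to contain move \<open>i\<close>, which activates condition
      \<open>i\<close>, and the first \<open>L\<close> moves of player \<open>v\<close>.\<close>
    define p where "p = map f [0..<2 * (L + i) + 2 + v]"
    have "legal p v i" using f v W_iff unfolding p_def by blast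
    moreover have moves: "moves v p j = (if j < L + i + 1 then Suc (f (2 * j + 1 + v)) else 0)" for j
      unfolding moves_def p_def initial_eq by auto
    moreover have "look_list p 0 = Suc (f 0)" unfolding p_def initial_eq by simp
    ultimately have "C (f 0) v (moves v p) i"
      unfolding legal_def by simp
    moreover have "partial_le (initial (\<lambda>j. f (2 * j + 1 + v)) L) (moves v p)"
      unfolding partial_le_def moves initial_eq by auto
    ultimately show "C (f 0) v (initial (\<lambda>j. f (2 * j + 1 + v)) L) i"
      by (rule closed_class_antimono[OF closed, rotated])
  qed
  interpret well_founded_tree W
  proof
    show "u \<in> W" if "u @ v \<in> W" for u v
      using that legal_prefix unfolding W_iff by blast
    show "\<not> (\<forall>L. map f [0..<L] \<in> W)" for f
    proof
      assume "\<forall>L. map f [0..<L] \<in> W"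
      then have "path (C (f 0) (of_bool (f 0 \<in> A))) (\<lambda>j. f (2 * j + 1 + of_bool (f 0 \<in> A)))"
        by (intro branch) (simp_all add: of_bool_def)
      with empty show False by blast
    qed
  qed
  have "decidable_on {{}} (\<lambda>X m. m \<in> list_encode ` W)"
  proof -
    have eq: "m \<in> list_encode ` W \<longleftrightarrow> (\<forall>i<m. \<forall>v<2. look m (2 * i + 1 + v) = 0 \<or>
        C (look m 0 - 1) v (\<lambda>j. look m (2 * j + 1 + v)) i)" (is "_ \<longleftrightarrow> ?R") for m
    proof -
      define p where "p = list_decode m"
      then have m: "m = list_encode p" by simp
      have "m \<in> list_encode ` W \<longleftrightarrow> p \<in> W"
        unfolding m by (simp add: inj_image_mem_iff inj_list_encode)
      also have "\<dots> \<longleftrightarrow> (\<forall>i<m. \<forall>v<2. legal p v i)"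
      proof
        show "\<forall>i<m. \<forall>v<2. legal p v i" if "p \<in> W" using that unfolding W_iff by blast
        show "p \<in> W" if "\<forall>i<m. \<forall>v<2. legal p v i"
          unfolding W_def using that length_le_list_encode[of p] m by simp
      qed
      also have "\<dots> \<longleftrightarrow> ?R"
        unfolding legal_def moves_def m look_list_encode ..
      finally show ?thesis .
    qed
    let ?L = "\<lambda>X a j. look (p1 a) (2 * j + 1 + p2 a)"
    have "decidable_on {{}} (\<lambda>X m. C (look (p1 (p1 m)) 0 - 1) (p2 m)
        (?L X (prod_encode (p1 (p1 m), p2 m))) (p2 (p1 m)))"
      by (intro dec computable_intros computable_on_look)
    then have *: "decidable_on {{}} (\<lambda>X m. C (look (p1 (p1 m)) 0 - 1) (p2 m)
        (\<lambda>j. look (p1 (p1 m)) (2 * j + 1 + p2 m)) (p2 (p1 m)))"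
      by (simp only: prod_encode_inverse fst_conv snd_conv)
    show ?thesis
      unfolding eq by (intro computable_intros computable_on_look *)
  qed
  then have rec: "recursive_set (list_encode ` W)"
    unfolding recursive_set_def turing_reducible_iff .
  have start: "[n] \<in> W" for n
    by (simp add: W_iff legal_def moves_def look_list_def)
  obtain V where V: "\<And>p. p \<in> W \<Longrightarrow> V p \<longleftrightarrow> (\<exists>k. p @ [k] \<in> W \<and> \<not> V (p @ [k]))"
    and hyp: "hyperarithmetic {n. V [n]}"
    using hyperarithmetic_winning_positions[OF rec start] by blast
  text \<open>The player who follows a path never runs out of legal moves, so the other one does.\<close>
  have win: "V [n] \<longleftrightarrow> odd (Suc v)" if f: "path (C n v) f" and v: "v < 2" for n v f
  proof -
    define follows where "follows p \<longleftrightarrow> p \<noteq> [] \<and> p ! 0 = n \<and>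
      (\<forall>j. 2 * j + 1 + v < length p \<longrightarrow> p ! (2 * j + 1 + v) = f j)" for p
    \<comment> \<open>\<open>odd (length p + v)\<close> says that player \<open>v\<close> is to
      move. By following the path this player always has a legal move, and every move of the
      opponent hands the turn back.\<close>
    have "follows p \<Longrightarrow> V p \<longleftrightarrow> odd (length p + v)" if "p \<in> W" for p
      using that
    proof (induction p rule: tree_induct)
      case (node p)
      show ?case
      proof (cases "odd (length p + v)")
        case True
        then obtain j where j: "length p = 2 * j + 1 + v"
        proof -
          have "length p \<ge> 1" using node.prems by (auto simp: follows_def Suc_le_eq)
          with True v have "length p = 2 * ((length p - 1 - v) div 2) + 1 + v" by presburger
          then show ?thesis by (rule that)
        qed
        have follows: "follows (p @ [f j])"
          unfolding follows_def
        proof (intro conjI allI impI)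
          show "(p @ [f j]) ! 0 = n" using node.prems by (auto simp: follows_def nth_append)
          fix i assume "2 * i + 1 + v < length (p @ [f j])"
          then show "(p @ [f j]) ! (2 * i + 1 + v) = f i"
            using node.prems j by (cases "i = j") (auto simp: follows_def nth_append)
        qed simp
        have "legal (p @ [f j]) u i" if "u < 2" for u i
        proof (cases "u = v")
          case True
          have "C n v (\<lambda>j. Suc (f j)) i" using f by (simp add: path_def)
          then have "C n v (moves v (p @ [f j])) i"
          proof (rule antimono)
            fix i assume "moves v (p @ [f j]) i \<noteq> 0"
            then show "moves v (p @ [f j]) i = Suc (f i)"
              using follows unfolding follows_def moves_def look_list_def by (auto split: if_splits)
          qed
          moreover have "look_list (p @ [f j]) 0 - 1 = n"
            using follows by (simp add: follows_def look_list_def)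
          ultimately show ?thesis using True by (simp add: legal_def)
        next
          case False
          have "2 * l + 1 + u \<noteq> length p" for l
            using j False v that by presburger
          then have "moves u (p @ [f j]) = moves u p"
            by (auto simp: moves_def look_list_def nth_append fun_eq_iff less_Suc_eq)
          moreover have "look_list (p @ [f j]) 0 = look_list p 0"
            using node.prems by (simp add: follows_def look_list_def nth_append)
          moreover have "legal p u i" using node.hyps that W_iff by blast
          ultimately show ?thesis by (simp add: legal_def)
        qed
        then have "p @ [f j] \<in> W" unfolding W_iff by blast
        moreover have "\<not> V (p @ [f j])" using node.IH[OF calculation follows] True by simp
        ultimately show ?thesis using V[OF node.hyps] True by blast
      next
        case False
        have "V (p @ [k])" if "p @ [k] \<in> W" for k
        proof -
          have "follows (p @ [k])"
            unfolding follows_def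
          proof (intro conjI allI impI)
            show "(p @ [k]) ! 0 = n" using node.prems by (auto simp: follows_def nth_append)
            fix i assume "2 * i + 1 + v < length (p @ [k])"
            moreover have "2 * i + 1 + v \<noteq> length p" using False by presburger
            ultimately show "(p @ [k]) ! (2 * i + 1 + v) = f i"
              using node.prems by (auto simp: follows_def nth_append)
          qed simp
          with node.IH[OF that] False show ?thesis by simp
        qed
        then show ?thesis using V[OF node.hyps] False by blast
      qed
    qed
    from this[OF start] show ?thesis by (simp add: follows_def)
  qed
  have "V [n] \<longleftrightarrow> n \<in> A" for n
  proof -
    obtain f where "path (C n (of_bool (n \<notin> A))) f" using nonempty by blast
    \<comment> \<open>Player \<open>0\<close> moves first after \<open>[n]\<close> and is the one
      with a path iff \<open>n\<close> is in \<open>A\<close>.\<close>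
    from win[OF this] show ?thesis by (cases "n \<in> A") simp_all
  qed
  with hyp show ?thesis by simp
qed

section \<open>Candidates\<close>

text \<open>A halting computation consults the oracle finitely often. With
  \<open>eventually\<close>, the bounds of subcomputations merge without naming maxima.\<close>

lemma run_use:
  assumes "run X c n = Some v"
  shows "eventually (\<lambda>u. \<forall>Z. (\<forall>j<u. j \<in> Z \<longleftrightarrow> j \<in> X) \<longrightarrow> run Z c n = Some v) sequentially"
  using assms
proof (induction c arbitrary: n v)
  case Oracle
  have "eventually (\<lambda>u. n < u) sequentially" by (rule eventually_gt_at_top)
  then show ?case by eventually_elim (use Oracle in auto)
next
  case (Pair f g)
  then obtain a b where "run X f n = Some a" "run X g n = Some b" "v = prod_encode (a, b)"
    by (auto simp: bind_eq_Some_conv)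
  then show ?case using Pair.IH(1)[of n a] Pair.IH(2)[of n b] by (auto elim: eventually_elim2)
next
  case (Comp f g)
  then obtain a where "run X g n = Some a" "run X f a = Some v"
    by (auto simp: bind_eq_Some_conv)
  then show ?case using Comp.IH(1)[of a v] Comp.IH(2)[of n a] by (auto elim: eventually_elim2)
next
  case (Prec f g)
  have "eventually (\<lambda>u. \<forall>Z. (\<forall>j<u. j \<in> Z \<longleftrightarrow> j \<in> X) \<longrightarrow> run Z (Prec f g) (prod_encode (a, k)) = Some v) sequentially"
    if "run X (Prec f g) (prod_encode (a, k)) = Some v" for a k v
    using that
  proof (induction k arbitrary: v)
    case 0
    then show ?case using Prec.IH(1)[of a v] by simp
  next
    case (Suc k)
    then obtain r where r: "run X (Prec f g) (prod_encode (a, k)) = Some r"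
      "run X g (prod_encode (a, prod_encode (k, r))) = Some v"
      by (auto simp: bind_eq_Some_conv)
    from Suc.IH[OF r(1)] Prec.IH(2)[OF r(2)] show ?case
      by eventually_elim simp
  qed
  from this[of "p1 n" "p2 n" v] Prec.prems show ?case by simp
next
  case (Mu f)
  then have *: "run X f (prod_encode (n, v)) = Some 0"
    "\<forall>j<v. \<exists>u>0. run X f (prod_encode (n, j)) = Some u"
    unfolding run_Mu_eq_Some_iff by blast+
  then obtain h where h: "\<And>j. j < v \<Longrightarrow> h j > 0 \<and> run X f (prod_encode (n, j)) = Some (h j)"
    by metis
  have "eventually (\<lambda>u. \<forall>j\<in>{..<v}. \<forall>Z. (\<forall>j<u. j \<in> Z \<longleftrightarrow> j \<in> X) \<longrightarrow> run Z f (prod_encode (n, j)) = Some (h j)) sequentially"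
    by (intro eventually_ball_finite ballI Mu.IH) (use h in auto)
  with Mu.IH[OF *(1)] show ?case
    unfolding run_Mu_eq_Some_iff
  proof eventually_elim
    case (elim u)
    then show ?case using h by (metis lessThan_iff)
  qed
qed auto

lemma run_use_bound:
  assumes "run X c n = Some v"
  obtains u where "\<And>Z. (\<And>j. j < u \<Longrightarrow> j \<in> Z \<longleftrightarrow> j \<in> X) \<Longrightarrow> run Z c n = Some v"
proof -
  obtain u where "\<forall>Z. (\<forall>j<u. j \<in> Z \<longleftrightarrow> j \<in> X) \<longrightarrow> run Z c n = Some v"
    using run_use[OF assms] unfolding eventually_sequentially by blast
  then show thesis using that[of u] by blast
qed

text \<open>Lists serve as characteristic functions, a member being a position with nonzero entry,
  so every number codes a finite set.\<close>

definition coded_set :: "nat \<Rightarrow> nat set" where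
  "coded_set d = {m. 1 < look d m}"

lemma finite_eq_coded_set:
  assumes "finite D"
  obtains d where "coded_set d = D"
proof -
  define N where "N = Suc (Max D)"
  have N: "D \<subseteq> {..<N}" using assms by (auto simp: N_def less_Suc_eq_le)
  have "coded_set (list_encode (map (\<lambda>m. of_bool (m \<in> D)) [0..<N])) = D"
    using N by (auto simp: coded_set_def initial_eq)
  then show thesis by (rule that)
qed

definition positive_oracle :: "nat set \<Rightarrow> nat set" where
  "positive_oracle D = {triple m 1 0 | m. m \<in> D}"

lemma triple_mem_positive_oracle: "triple m x l \<in> positive_oracle D \<longleftrightarrow> m \<in> D \<and> x = 1 \<and> l = 0"
  by (auto simp: positive_oracle_def triple_def)

lemma le_triple: "m \<le> triple m x l"
  by (simp add: triple_def le_prod_encode_1)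

lemma generic_positive_oracle:
  assumes "D \<subseteq> B" "density_one D"
  shows "generic_oracle (positive_oracle D) B"
proof -
  have "oracle_dom (positive_oracle D) = D"
    by (auto simp: oracle_dom_def triple_mem_positive_oracle)
  then show ?thesis
    using assms by (auto simp: generic_oracle_def partial_oracle_def triple_mem_positive_oracle)
qed

text \<open>
  A path of \<open>candidate c n v\<close> consists, interleaved, of the evaluation table for the positive
  oracles of all finite sets, a set, and a modulus witnessing that this set has density one; and
  \<open>c\<close> does not answer \<open>v\<close> at any \<open>2\<^sup>n * k\<close> with \<open>k\<close> odd when its oracle is the positive oracle
  of a finite subset.
\<close>

definition candidate :: "code \<Rightarrow> nat \<Rightarrow> nat \<Rightarrow> (nat \<Rightarrow> nat) \<Rightarrow> nat \<Rightarrow> bool" where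
  "candidate c n v G i \<longleftrightarrow>
     (let k = p1 (p2 i); N = p2 (p2 i) in
      if p1 i = 0 then
        table_condition (\<lambda>d x. p1 (p2 x) = 1 \<and> p2 (p2 x) = 0 \<and> 1 < look d (p1 x))
          (\<lambda>d x. flag_index (code_num Zero)) (\<lambda>j. G (3 * j)) (p2 i)
      else if p1 i = 1 then
        (G (3 * k + 2) \<noteq> 0 \<and> (\<forall>j<N. G (3 * j + 1) \<noteq> 0) \<and> G (3 * k + 2) - 1 \<le> N \<longrightarrow>
         k * (\<Sum>j<N. of_bool (G (3 * j + 1) = 1)) \<le> N)
      else
        (G (3 * eval_index k (code_num c) (2 ^ n * (2 * N + 1))) = v + 2 \<longrightarrow>
         (\<exists>m<k. 1 < look k m \<and> G (3 * m + 1) \<le> 1)))"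

lemma closed_class_candidate: "closed_class (candidate c n v)"
  unfolding closed_class_def
proof (intro conjI allI impI)
  fix G G' i
  assume le: "partial_le G G'" and G': "candidate c n v G' i"
  have eq: "G j = G' j" if "G j \<noteq> 0" for j using le that unfolding partial_le_def by metis
  consider "p1 i = 0" | "p1 i = 1" | "p1 i > 1" by linarith
  then show "candidate c n v G i"
  proof cases
    case 1
    have "partial_le (\<lambda>j. G (3 * j)) (\<lambda>j. G' (3 * j))"
      using le by (simp add: partial_le_def)
    with 1 G' show ?thesis
      using closed_class_antimono[OF closed_class_table_condition] by (simp add: candidate_def)
  next
    case 2
    define k N where "k = p1 (p2 i)" and "N = p2 (p2 i)"
    have "k * (\<Sum>j<N. of_bool (G (3 * j + 1) = 1)) \<le> N"
      if "G (3 * k + 2) \<noteq> 0" "\<forall>j<N. G (3 * j + 1) \<noteq> 0" "G (3 * k + 2) - 1 \<le> N"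
    proof -
      have "(\<Sum>j<N. of_bool (G (3 * j + 1) = 1)) = (\<Sum>j<N. of_bool (G' (3 * j + 1) = 1) :: nat)"
        by (rule sum.cong) (use that(2) eq in auto)
      moreover have "G' (3 * k + 2) \<noteq> 0" "\<forall>j<N. G' (3 * j + 1) \<noteq> 0" "G' (3 * k + 2) - 1 \<le> N"
        using that eq by metis+
      ultimately show ?thesis using G' 2 unfolding candidate_def Let_def k_def N_def by simp
    qed
    with 2 show ?thesis unfolding candidate_def Let_def k_def N_def by simp
  next
    case 3
    define k N where "k = p1 (p2 i)" and "N = p2 (p2 i)"
    have "\<exists>m<k. 1 < look k m \<and> G (3 * m + 1) \<le> 1"
      if "G (3 * eval_index k (code_num c) (2 ^ n * (2 * N + 1))) = v + 2"
    proof -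
      have "G' (3 * eval_index k (code_num c) (2 ^ n * (2 * N + 1))) = v + 2"
        using that eq by (metis add_is_0 zero_neq_numeral)
      then obtain m where "m < k" "1 < look k m" "G' (3 * m + 1) \<le> 1"
        using G' 3 unfolding candidate_def Let_def k_def N_def by auto
      moreover have "G (3 * m + 1) \<le> 1" using calculation(3) eq[of "3 * m + 1"] by (cases "G (3 * m + 1) = 0") auto
      ultimately show ?thesis by blast
    qed
    with 3 show ?thesis unfolding candidate_def Let_def k_def N_def by simp
  qed
next
  fix f i
  assume L: "\<forall>L. candidate c n v (initial f L) i"
  consider "p1 i = 0" | "p1 i = 1" | "p1 i > 1" by linarith
  then show "candidate c n v (\<lambda>j. Suc (f j)) i"
  proof cases
    case 1
    let ?T = "table_condition (\<lambda>d x. p1 (p2 x) = 1 \<and> p2 (p2 x) = 0 \<and> 1 < look d (p1 x))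
          (\<lambda>d x. flag_index (code_num Zero))"
    have "?T (initial (\<lambda>j. f (3 * j)) l) (p2 i)" for l
    proof -
      have "?T (\<lambda>j. initial f (3 * l) (3 * j)) (p2 i)"
        using L 1 by (simp add: candidate_def)
      moreover have "partial_le (initial (\<lambda>j. f (3 * j)) l) (\<lambda>j. initial f (3 * l) (3 * j))"
        by (simp add: partial_le_def initial_eq)
      ultimately show ?thesis
        using closed_class_antimono[OF closed_class_table_condition] by blast
    qed
    then have "?T (\<lambda>j. Suc (f (3 * j))) (p2 i)"
      by (rule closed_class_limit[OF closed_class_table_condition])
    then show ?thesis using 1 by (simp add: candidate_def)
  next
    case 2
    define k N where "k = p1 (p2 i)" and "N = p2 (p2 i)"
    have "candidate c n v (initial f (3 * k + 3 * N + 3)) i" using L by blast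
    then show ?thesis
      using 2 unfolding candidate_def Let_def k_def[symmetric] N_def[symmetric]
      by (simp add: initial_eq)
  next
    case 3
    define k N where "k = p1 (p2 i)" and "N = p2 (p2 i)"
    define I where "I = 3 * eval_index k (code_num c) (2 ^ n * (2 * N + 1))"
    have "candidate c n v (initial f (Suc I + 3 * k)) i" using L by blast
    then show ?thesis
      using 3 unfolding candidate_def Let_def k_def[symmetric] N_def[symmetric] I_def[symmetric] initial_eq
      by auto
  qed
qed

lemma decidable_on_candidate:
  assumes G: "computable_on S (\<lambda>X m. G X (p1 m) (p2 m))"
    and n: "computable_on S n" and v: "computable_on S v" and s: "computable_on S s" and i: "computable_on S i"
  shows "decidable_on S (\<lambda>X m. candidate c (n X m) (v X m) (G X (s X m)) (i X m))"
proof -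
  have table: "decidable_on S (\<lambda>X m. table_condition (\<lambda>d x. p1 (p2 x) = 1 \<and> p2 (p2 x) = 0 \<and> 1 < look d (p1 x))
      (\<lambda>d x. flag_index (code_num Zero)) (\<lambda>j. G X (p1 m) (3 * j)) (p2 m))"
    by (intro decidable_on_table_condition computable_intros computable_on_look computable_on_compose2[OF G])
  show ?thesis
    unfolding candidate_def Let_def
    by (intro computable_intros computable_on_look computable_on_compose2[OF G] computable_on_compose2[OF table]
        n v s i computable_on_compose[OF n] computable_on_compose[OF v] computable_on_compose[OF s] computable_on_compose[OF i])
qed

text \<open>Choice collects the bounds into a modulus; carrying it along with the set makes density
  one a closed condition.\<close>

lemma density_one_modulus:
  "density_one B \<longleftrightarrow> (\<exists>h. \<forall>k N. h k \<le> N \<longrightarrow> k * (\<Sum>j<N. of_bool (j \<notin> B)) \<le> N)"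
proof -
  have "(\<Sum>j<N. of_bool (j \<notin> B)) = card ({..<N} - B)" for N
  proof -
    have "{..<N} \<inter> {j. j \<notin> B} = {..<N} - B" by blast
    then show ?thesis by (simp only: sum_of_bool_eq finite_lessThan of_nat_id)
  qed
  then show ?thesis unfolding density_one_iff choice_iff by (simp only:)
qed

text \<open>The table part of a path is forced. What remains is a set with a modulus, and the last
  kind of condition then speaks of true computations of \<open>c\<close> from finite sets.\<close>

lemma ex_path_candidate_iff:
  "(\<exists>f. path (candidate c n v) f) \<longleftrightarrow>
   (\<exists>B. density_one B \<and> (\<forall>D k. finite D \<longrightarrow> D \<subseteq> B \<longrightarrow>
      run (positive_oracle D) c (2 ^ n * (2 * k + 1)) \<noteq> Some v))"
proof -
  define t where "t d x \<longleftrightarrow> p1 (p2 x) = 1 \<and> p2 (p2 x) = 0 \<and> 1 < look d (p1 x)" for d x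
  \<comment> \<open>Membership in a finite set is decided by \<open>t\<close> alone:
    \<open>r\<close> points at the flag of an actual program, which is never \<open>0\<close> on a
    path.\<close>
  define r where "r d x = flag_index (code_num Zero)" for d x :: nat
  define Y where "Y d = positive_oracle (coded_set d)" for d
  have Y: "x \<in> Y d \<longleftrightarrow> t d x" for x d
  proof -
    have "triple (p1 x) (p1 (p2 x)) (p2 (p2 x)) = x" by (simp add: triple_def)
    then show ?thesis
      using triple_mem_positive_oracle[of "p1 x" "p1 (p2 x)" "p2 (p2 x)" "coded_set d"]
      by (auto simp: Y_def t_def coded_set_def)
  qed
  have query: "x \<in> Y d \<longleftrightarrow> t d x \<and> eval_table Y (r d x) \<noteq> 0" for x d
    unfolding Y r_def by (simp only: eval_table_simps rangeI of_bool_eq one_neq_zero simp_thms)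
  have path_iff: "path (candidate c n v) f \<longleftrightarrow>
      path (table_condition t r) (\<lambda>j. f (3 * j)) \<and>
      (\<forall>k N. f (3 * k + 2) \<le> N \<longrightarrow> k * (\<Sum>j<N. of_bool (f (3 * j + 1) = 0)) \<le> N) \<and>
      (\<forall>d k. f (3 * eval_index d (code_num c) (2 ^ n * (2 * k + 1))) = Suc v \<longrightarrow>
        (\<exists>m<d. 1 < look d m \<and> f (3 * m + 1) = 0))" (is "_ \<longleftrightarrow> ?T \<and> ?M \<and> ?N") for f
  proof
    assume "path (candidate c n v) f"
    then have *: "candidate c n v (\<lambda>j. Suc (f j)) (prod_encode (a, b))" for a b
      unfolding path_def by blast
    have ?T
      unfolding path_def t_def r_def by (intro allI) (use *[of 0] in \<open>simp add: candidate_def\<close>)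
    moreover have ?M using *[of 1 "prod_encode (k, N)" for k N] by (simp add: candidate_def)
    moreover have ?N using *[of 2 "prod_encode (d, k)" for d k] by (simp add: candidate_def)
    ultimately show "?T \<and> ?M \<and> ?N" by blast
  next
    assume *: "?T \<and> ?M \<and> ?N"
    show "path (candidate c n v) f"
      unfolding path_def
    proof
      fix i
      define k N where "k = p1 (p2 i)" and "N = p2 (p2 i)"
      have "table_condition t r (\<lambda>j. Suc (f (3 * j))) (p2 i)"
        using * unfolding path_def by blast
      moreover have "f (3 * k + 2) \<le> N \<longrightarrow> k * (\<Sum>j<N. of_bool (f (3 * j + 1) = 0)) \<le> N"
        using * by blast
      moreover have "f (3 * eval_index k (code_num c) (2 ^ n * (2 * N + 1))) = Suc v \<longrightarrow>
        (\<exists>m<k. 1 < look k m \<and> f (3 * m + 1) = 0)"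
        using * by blast
      ultimately show "candidate c n v (\<lambda>j. Suc (f j)) i"
        unfolding candidate_def Let_def t_def r_def k_def[symmetric] N_def[symmetric] by simp
    qed
  qed
  have table_value: "f (3 * eval_index d (code_num c) x) = option_value (run (Y d) c x)"
    if "path (table_condition t r) (\<lambda>j. f (3 * j))" for f d x
  proof (rule path_table_value[OF that])
    fix x
    show "x \<in> Y d \<longleftrightarrow> t d x \<and> f (3 * r d x) \<noteq> 0"
      unfolding Y r_def
      by (simp only: path_table_flag[OF that] rangeI of_bool_eq one_neq_zero simp_thms)
  qed
  have less: "m < d" if "1 < look d m" for m d
    using that length_le_list_encode[of "list_decode d"] by (auto simp: look_def split: if_splits)
  show ?thesis
  proof
    assume "\<exists>f. path (candidate c n v) f"
    then obtain f where "path (candidate c n v) f" ..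
    note f_props = path_iff[THEN iffD1, OF this]
    note f = f_props[THEN conjunct1] f_props[THEN conjunct2, THEN conjunct1, rule_format]
      f_props[THEN conjunct2, THEN conjunct2, rule_format]
    define B where "B = {m. f (3 * m + 1) \<noteq> 0}"
    have "density_one B"
      unfolding density_one_modulus by (rule exI[of _ "\<lambda>k. f (3 * k + 2)"]) (use f(2) in \<open>simp add: B_def\<close>)
    moreover have "run (positive_oracle D) c (2 ^ n * (2 * k + 1)) \<noteq> Some v" if D: "finite D" "D \<subseteq> B" for D k
    proof
      assume run: "run (positive_oracle D) c (2 ^ n * (2 * k + 1)) = Some v"
      obtain d where d: "coded_set d = D" using finite_eq_coded_set[OF D(1)] .
      have "f (3 * eval_index d (code_num c) (2 ^ n * (2 * k + 1))) = Suc v"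
        using run unfolding table_value[OF f(1)] Y_def d by simp
      then obtain m where "1 < look d m" "f (3 * m + 1) = 0" using f(3) by blast
      then have "m \<in> D" "m \<notin> B" unfolding d[symmetric] by (simp_all add: coded_set_def B_def)
      with D(2) show False by blast
    qed
    ultimately show "\<exists>B. density_one B \<and> (\<forall>D k. finite D \<longrightarrow> D \<subseteq> B \<longrightarrow>
      run (positive_oracle D) c (2 ^ n * (2 * k + 1)) \<noteq> Some v)" by blast
  next
    assume "\<exists>B. density_one B \<and> (\<forall>D k. finite D \<longrightarrow> D \<subseteq> B \<longrightarrow>
      run (positive_oracle D) c (2 ^ n * (2 * k + 1)) \<noteq> Some v)"
    then obtain B where B: "density_one B" "\<And>D k. finite D \<Longrightarrow> D \<subseteq> B \<Longrightarrow>
      run (positive_oracle D) c (2 ^ n * (2 * k + 1)) \<noteq> Some v" by blast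
    then obtain h where h: "\<And>k N. h k \<le> N \<Longrightarrow> k * (\<Sum>j<N. of_bool (j \<notin> B)) \<le> N"
      unfolding density_one_modulus by blast
    \<comment> \<open>Interleaves the true table, the characteristic function of \<open>B\<close>
      and the modulus.\<close>
    define f where "f i = (if i mod 3 = 0 then eval_table Y (i div 3)
      else if i mod 3 = 1 then of_bool (i div 3 \<in> B) else h (i div 3))" for i
    have f [simp]: "f (3 * j) = eval_table Y j" "f (Suc (3 * j)) = of_bool (j \<in> B)"
      "f (Suc (Suc (3 * j))) = h j" for j
    proof -
      have "Suc (3 * j) mod 3 = 1" "Suc (3 * j) div 3 = j"
        "Suc (Suc (3 * j)) mod 3 = 2" "Suc (Suc (3 * j)) div 3 = j" by presburger+
      then show "f (3 * j) = eval_table Y j" "f (Suc (3 * j)) = of_bool (j \<in> B)"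
        "f (Suc (Suc (3 * j))) = h j" by (simp_all add: f_def)
    qed
    have "path (table_condition t r) (\<lambda>j. f (3 * j))"
      using path_eval_table[of Y t r, OF query] by simp
    moreover have "k * (\<Sum>j<N. of_bool (f (3 * j + 1) = 0)) \<le> N" if "f (3 * k + 2) \<le> N" for k N
      using h[of k N] that by simp
    moreover have "\<exists>m<d. 1 < look d m \<and> f (3 * m + 1) = 0"
      if "f (3 * eval_index d (code_num c) (2 ^ n * (2 * k + 1))) = Suc v" for d k
    proof -
      have "run (Y d) c (2 ^ n * (2 * k + 1)) = Some v"
        using that by (simp only: f eval_table_simps option_value_simps)
      moreover have "finite (coded_set d)"
        by (rule finite_subset[of _ "{..<d}"]) (auto simp: coded_set_def intro: less)
      ultimately have "\<not> coded_set d \<subseteq> B" using B(2) unfolding Y_def by blast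
      then obtain m where "1 < look d m" "m \<notin> B" unfolding coded_set_def by blast
      then show ?thesis using less by (intro exI[of _ m]) simp
    qed
    ultimately have "path (candidate c n v) f"
      unfolding path_iff by (intro conjI allI impI)
    show "\<exists>f. path (candidate c n v) f"
      by (rule exI[of _ f]) (rule \<open>path (candidate c n v) f\<close>)
  qed
qed

lemma generically_reduces_imp_hyperarithmetic:
  assumes B: "density_one B" and "B \<ge>\<^sub>g \<R> A"
  shows "hyperarithmetic A"
proof -
  from assms(2) obtain c where c: "\<And>P. generic_oracle P B \<Longrightarrow> generic_computation (run P c) (\<R> A)"
    unfolding generically_reduces_def by blast
  have nonempty: "\<exists>f. path (candidate c n (of_bool (n \<notin> A))) f" for n
    unfolding ex_path_candidate_iff
  proof (intro exI[of _ B] conjI B allI impI notI)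
    fix D k assume D: "finite D" "D \<subseteq> B"
      and run: "run (positive_oracle D) c (2 ^ n * (2 * k + 1)) = Some (of_bool (n \<notin> A))"
    obtain u where u: "\<And>Z. (\<And>j. j < u \<Longrightarrow> j \<in> Z \<longleftrightarrow> j \<in> positive_oracle D) \<Longrightarrow>
        run Z c (2 ^ n * (2 * k + 1)) = Some (of_bool (n \<notin> A))"
      using run_use_bound[OF run] by blast
    \<comment> \<open>Adding members of \<open>B\<close> above the use makes the domain density one
      without disturbing the computation, so \<open>c\<close> would answer wrongly from a generic
      oracle for \<open>B\<close>.\<close>
    define P where "P = positive_oracle D \<union> positive_oracle (B - {..<u})"
    have "generic_oracle P B"
    proof -
      have "partial_oracle P B"
        using D(2) by (auto simp: P_def partial_oracle_def triple_mem_positive_oracle)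
      moreover have "B - {..<u} \<subseteq> oracle_dom P"
        by (auto simp: P_def oracle_dom_def triple_mem_positive_oracle)
      then have "density_one (oracle_dom P)"
        by (rule density_one_mono[rotated]) (simp add: density_one_Diff_finite B)
      ultimately show ?thesis by (simp add: generic_oracle_def)
    qed
    then have "generic_computation (run P c) (\<R> A)" by (rule c)
    moreover have "run P c (2 ^ n * (2 * k + 1)) = Some (of_bool (n \<notin> A))"
    proof (rule u)
      fix j assume "j < u"
      have "u \<le> triple m 1 0" if "m \<in> B - {..<u}" for m
        using that le_triple[of m 1 0] by simp
      with \<open>j < u\<close> have "j \<notin> positive_oracle (B - {..<u})"
        unfolding positive_oracle_def using not_less by blast
      then show "j \<in> P \<longleftrightarrow> j \<in> positive_oracle D" by (simp add: P_def)
    qed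
    ultimately show False
      unfolding generic_computation_def using R_iff[of n k A] by (auto simp: dom_def)
  qed
  have empty: "\<not> path (candidate c n (of_bool (n \<in> A))) f" for n f
  proof
    assume "path (candidate c n (of_bool (n \<in> A))) f"
    then obtain B' where B': "density_one B'" and no: "\<And>D k. finite D \<Longrightarrow> D \<subseteq> B' \<Longrightarrow>
        run (positive_oracle D) c (2 ^ n * (2 * k + 1)) \<noteq> Some (of_bool (n \<in> A))"
      using ex_path_candidate_iff by blast
    \<comment> \<open>Positive information about \<open>B \<inter> B'\<close> is a generic oracle
      for \<open>B\<close>, so \<open>c\<close> answers correctly somewhere in column
      \<open>n\<close>. The finitely many members consulted lie in \<open>B'\<close>, against the
      choice of \<open>B'\<close>.\<close>
    define P where "P = positive_oracle (B \<inter> B')"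
    have "generic_oracle P B"
      unfolding P_def by (rule generic_positive_oracle) (simp_all add: density_one_Int B B')
    then have comp: "generic_computation (run P c) (\<R> A)" by (rule c)
    then obtain k where "2 ^ n * (2 * k + 1) \<in> dom (run P c)"
      using density_one_meets_column unfolding generic_computation_def by blast
    then have run: "run P c (2 ^ n * (2 * k + 1)) = Some (of_bool (n \<in> A))"
      using comp R_iff[of n k A] unfolding generic_computation_def by simp
    obtain u where u: "\<And>Z. (\<And>j. j < u \<Longrightarrow> j \<in> Z \<longleftrightarrow> j \<in> P) \<Longrightarrow>
        run Z c (2 ^ n * (2 * k + 1)) = Some (of_bool (n \<in> A))"
      using run_use_bound[OF run] by blast
    have "run (positive_oracle (B \<inter> B' \<inter> {..<u})) c (2 ^ n * (2 * k + 1)) = Some (of_bool (n \<in> A))"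
    proof (rule u)
      fix j assume "j < u"
      have "m < u" if "triple m 1 0 < u" for m
        using that le_triple[of m 1 0] by simp
      with \<open>j < u\<close> show "j \<in> positive_oracle (B \<inter> B' \<inter> {..<u}) \<longleftrightarrow> j \<in> P"
        by (auto simp: P_def positive_oracle_def)
    qed
    then show False using no[of "B \<inter> B' \<inter> {..<u}" k] by auto
  qed
  show ?thesis
  proof (rule hyperarithmetic_if_separated[of "candidate c"])
    show "closed_class (candidate c n v)" for n v by (rule closed_class_candidate)
  qed (fact decidable_on_candidate nonempty empty)+
qed

theorem mainTheorem1:
  fixes A :: "nat set"
  shows "hyperarithmetic A \<longleftrightarrow> (\<exists>B :: nat set. density_one B \<and> B \<ge>\<^sub>g \<R> A)"
  using hyperarithmetic_imp_generically_reduces generically_reduces_imp_hyperarithmetic by blast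

end
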